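(* Let $(A,\mathcal H)$ be a commutative Hopf algebroid over $\Bbbk$. The pair $\big(A,\mathrm{Der}_\Bbbk^{\,s}(\mathcal H,A_\varepsilon)\big)$ is a Lie-Rinehart algebra with anchor map $$\omega:\mathrm{Der}_\Bbbk^{\,s}(\mathcal H,A_\varepsilon)\longrightarrow\mathrm{Der}_\Bbbk(A),\qquad \delta\longmapsto\delta\circ t .$$
   Context: $\Bbbk$ is a field of characteristic $0$. A commutative Hopf algebroid $(A,\mathcal H)$ over $\Bbbk$ consists of commutative $\Bbbk$-algebras with algebra maps $s,t:A\to\mathcal H$, $\Delta:\mathcal H\to\mathcal H\otimes_A\mathcal H$ ($u\mapsto u_1\otimes_Au_2$), $\varepsilon:\mathcal H\to A$, $\mathcal S:\mathcal H\to\mathcal H$, where $\mathcal H$ is the $A$-bimodule ${}_s\mathcal H_t$ (left via $s$, right via $t$), $\Delta,\varepsilon$ are $A$-bilinear, coassociative and counital, $\mathcal Ss=t$, $\mathcal St=s$, $\mathcal S^2=\mathrm{id}$, $\mathcal S(h_1)h_2=t(\varepsilon(h))$, $h_1\mathcal S(h_2)=s(\varepsilon(h))$. $\mathrm{Der}_\Bbbk^{\,s}(\mathcal H,A_\varepsilon)$ is the set of $\Bbbk$-linear $\delta:\mathcal H\to A$ with $\delta\circ s=0$ and $\delta(uv)=\varepsilon(u)\delta(v)+\delta(u)\varepsilon(v)$; it is an $A$-module by $(a\delta)(u)=a\delta(u)$ and has the bracket $$[\delta,\delta'](u)=\delta\big(u_1t(\delta'(u_2))\big)-\delta'\big(u_1t(\delta(u_2))\big).$$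 A Lie-Rinehart algebra $(A,L)$ is a Lie $\Bbbk$-algebra $L$ that is also an $A$-module, with an $A$-linear morphism of Lie algebras $\omega:L\to\mathrm{Der}_\Bbbk(A)$ (the anchor) such that $[X,aY]=a[X,Y]+\omega(X)(a)Y$ for all $X,Y\in L$, $a\in A$. *)

theory Defs
  imports "HOL-Algebra.Module" "HOL-Algebra.Free_Abelian_Groups"
begin

locale field_char_zero = field K for K (structure) +
  assumes char_zero: "0 < n \<Longrightarrow> [(n::nat)] \<cdot> \<one> \<noteq> \<zero>"

definition linear_map ::
  "('r, 'c) ring_scheme \<Rightarrow> ('r, 'm, 'd) module_scheme \<Rightarrow> ('r, 'n, 'e) module_scheme \<Rightarrow> ('m \<Rightarrow> 'n) \<Rightarrow> bool"
  where "linear_map R M N f \<longleftrightarrow>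
    f \<in> carrier M \<rightarrow> carrier N \<and>
    (\<forall>x\<in>carrier M. \<forall>y\<in>carrier M. f (x \<oplus>\<^bsub>M\<^esub> y) = f x \<oplus>\<^bsub>N\<^esub> f y) \<and>
    (\<forall>r\<in>carrier R. \<forall>x\<in>carrier M. f (r \<odot>\<^bsub>M\<^esub> x) = r \<odot>\<^bsub>N\<^esub> f x)"

definition algebra_map ::
  "('r, 'c) ring_scheme \<Rightarrow> ('r, 'm, 'd) module_scheme \<Rightarrow> ('r, 'n, 'e) module_scheme \<Rightarrow> ('m \<Rightarrow> 'n) \<Rightarrow> bool"
  where "algebra_map R M N f \<longleftrightarrow> f \<in> ring_hom M N \<and> linear_map R M N f"

definition with_smult :: "('k, 'm, 'd) module_scheme \<Rightarrow> ('a \<Rightarrow> 'm \<Rightarrow> 'm) \<Rightarrow> ('a, 'm) module"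
  where "with_smult M act =
    \<lparr>carrier = carrier M, monoid.mult = monoid.mult M, one = one M,
     ring.zero = ring.zero M, ring.add = ring.add M, smult = act\<rparr>"

text \<open>
  The tensor product \<open>P \<otimes>\<^sub>A Q\<close> of commutative algebras, where \<open>P\<close> is a right \<open>A\<close>-module through
  \<open>tP : A \<rightarrow> P\<close> and \<open>Q\<close> is a left \<open>A\<close>-module through \<open>sQ : A \<rightarrow> Q\<close>: the free abelian group on
  pairs modulo biadditivity and \<open>x tP(a) \<otimes> y = x \<otimes> sQ(a) y\<close>. Its elements are cosets.
\<close>

definition tensor_relations ::
  "('a, 'c) ring_scheme \<Rightarrow> ('p, 'd) ring_scheme \<Rightarrow> ('a \<Rightarrow> 'p) \<Rightarrow> ('q, 'e) ring_scheme \<Rightarrow> ('a \<Rightarrow> 'q)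
     \<Rightarrow> ('p \<times> 'q \<Rightarrow>\<^sub>0 int) set"
  where "tensor_relations A P tP Q sQ =
    {frag_of (x \<oplus>\<^bsub>P\<^esub> x', y) - frag_of (x, y) - frag_of (x', y) | x x' y.
        x \<in> carrier P \<and> x' \<in> carrier P \<and> y \<in> carrier Q} \<union>
    {frag_of (x, y \<oplus>\<^bsub>Q\<^esub> y') - frag_of (x, y) - frag_of (x, y') | x y y'.
        x \<in> carrier P \<and> y \<in> carrier Q \<and> y' \<in> carrier Q} \<union>
    {frag_of (x \<otimes>\<^bsub>P\<^esub> tP a, y) - frag_of (x, sQ a \<otimes>\<^bsub>Q\<^esub> y) | x a y.
        x \<in> carrier P \<and> a \<in> carrier A \<and> y \<in> carrier Q}"

definition tensor_kernel ::
  "('a, 'c) ring_scheme \<Rightarrow> ('p, 'd) ring_scheme \<Rightarrow> ('a \<Rightarrow> 'p) \<Rightarrow> ('q, 'e) ring_scheme \<Rightarrow> ('a \<Rightarrow> 'q)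
     \<Rightarrow> ('p \<times> 'q \<Rightarrow>\<^sub>0 int) set"
  where "tensor_kernel A P tP Q sQ =
    generate (free_Abelian_group (carrier P \<times> carrier Q)) (tensor_relations A P tP Q sQ)"

definition tensor_group ::
  "('a, 'c) ring_scheme \<Rightarrow> ('p, 'd) ring_scheme \<Rightarrow> ('a \<Rightarrow> 'p) \<Rightarrow> ('q, 'e) ring_scheme \<Rightarrow> ('a \<Rightarrow> 'q)
     \<Rightarrow> ('p \<times> 'q \<Rightarrow>\<^sub>0 int) set monoid"
  where "tensor_group A P tP Q sQ =
    free_Abelian_group (carrier P \<times> carrier Q) Mod tensor_kernel A P tP Q sQ"

definition pure_tensor ::
  "('a, 'c) ring_scheme \<Rightarrow> ('p, 'd) ring_scheme \<Rightarrow> ('a \<Rightarrow> 'p) \<Rightarrow> ('q, 'e) ring_scheme \<Rightarrow> ('a \<Rightarrow> 'q)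
     \<Rightarrow> 'p \<Rightarrow> 'q \<Rightarrow> ('p \<times> 'q \<Rightarrow>\<^sub>0 int) set"
  where "pure_tensor A P tP Q sQ x y =
    tensor_kernel A P tP Q sQ #>\<^bsub>free_Abelian_group (carrier P \<times> carrier Q)\<^esub> frag_of (x, y)"

text \<open>
  \<open>tensor_lift G f X\<close> is the value at \<open>X \<in> P \<otimes>\<^sub>A Q\<close> of the homomorphism \<open>x \<otimes> y \<mapsto> f x y\<close> into
  the commutative group \<open>G\<close> (written multiplicatively): if \<open>X\<close> is the class of
  \<open>\<Sum>\<^sub>i n\<^sub>i (x\<^sub>i, y\<^sub>i)\<close>, it is the product of the \<open>f x\<^sub>i y\<^sub>i\<close> to the powers \<open>n\<^sub>i\<close>. It is meaningful
  (independent of the representative) when \<open>f\<close> is biadditive and \<open>A\<close>-balanced, as it is wherever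
  it is used below. So in Sweedler notation \<open>tensor_lift (add_monoid G) f (\<Delta> u)\<close> is \<open>f u\<^sub>1 u\<^sub>2\<close>.
\<close>

definition free_lift :: "('g, 'c) monoid_scheme \<Rightarrow> ('p \<Rightarrow> 'q \<Rightarrow> 'g) \<Rightarrow> ('p \<times> 'q \<Rightarrow>\<^sub>0 int) \<Rightarrow> 'g"
  where "free_lift G f c =
    finprod G (\<lambda>p. f (fst p) (snd p) [^]\<^bsub>G\<^esub> Poly_Mapping.lookup c p) (Poly_Mapping.keys c)"

definition tensor_lift :: "('g, 'c) monoid_scheme \<Rightarrow> ('p \<Rightarrow> 'q \<Rightarrow> 'g) \<Rightarrow> ('p \<times> 'q \<Rightarrow>\<^sub>0 int) set \<Rightarrow> 'g"
  where "tensor_lift G f X = the_elem (free_lift G f ` X)"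

text \<open>
  The product is \<open>(x \<otimes> y)(x' \<otimes> y') = x x' \<otimes> y y'\<close> and scalars act by \<open>c(x \<otimes> y) = (c x) \<otimes> y\<close>.
\<close>

definition tensor_algebra ::
  "('a, 'c) ring_scheme \<Rightarrow> ('k, 'p, 'd) module_scheme \<Rightarrow> ('a \<Rightarrow> 'p) \<Rightarrow> ('k, 'q, 'e) module_scheme \<Rightarrow> ('a \<Rightarrow> 'q)
     \<Rightarrow> ('k, ('p \<times> 'q \<Rightarrow>\<^sub>0 int) set) module"
  where "tensor_algebra A P tP Q sQ = (let T = tensor_group A P tP Q sQ; pt = pure_tensor A P tP Q sQ in
    \<lparr>carrier = carrier T,
     monoid.mult = (\<lambda>X Y. tensor_lift T
       (\<lambda>x y. tensor_lift T (\<lambda>x' y'. pt (x \<otimes>\<^bsub>P\<^esub> x') (y \<otimes>\<^bsub>Q\<^esub> y')) Y) X),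
     one = pt \<one>\<^bsub>P\<^esub> \<one>\<^bsub>Q\<^esub>,
     ring.zero = \<one>\<^bsub>T\<^esub>,
     ring.add = monoid.mult T,
     smult = (\<lambda>c. tensor_lift T (\<lambda>x y. pt (c \<odot>\<^bsub>P\<^esub> x) y))\<rparr>)"

text \<open>
  Commutative Hopf algebroids. \<open>\<H>\<close> is the \<open>A\<close>-bimodule with left action through \<open>s\<close> and right
  action through \<open>t\<close>; accordingly \<open>A\<close> acts on \<open>\<H> \<otimes>\<^sub>A \<H>\<close> on the left through \<open>s\<^sub>2\<close> (\<open>s a \<otimes> 1\<close>) and
  on the right through \<open>t\<^sub>2\<close> (\<open>1 \<otimes> t a\<close>).
\<close>

locale hopf_algebroid_data =
  A: algebra K A + H: algebra K H
  for K :: "('k, 'c) ring_scheme"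
    and A :: "('k, 'a, 'd) module_scheme"
    and H :: "('k, 'h, 'e) module_scheme" +
  fixes s t :: "'a \<Rightarrow> 'h"
    and \<Delta> :: "'h \<Rightarrow> ('h \<times> 'h \<Rightarrow>\<^sub>0 int) set"
    and \<epsilon> :: "'h \<Rightarrow> 'a"
    and S :: "'h \<Rightarrow> 'h"
begin

abbreviation "ten \<equiv> pure_tensor A H t H s"
abbreviation "HH \<equiv> tensor_algebra A H t H s"
abbreviation "s\<^sub>2 \<equiv> \<lambda>a. ten (s a) \<one>\<^bsub>H\<^esub>"
abbreviation "t\<^sub>2 \<equiv> \<lambda>a. ten \<one>\<^bsub>H\<^esub> (t a)"

abbreviation "ten_l \<equiv> pure_tensor A HH t\<^sub>2 H s"
abbreviation "HH_H \<equiv> tensor_algebra A HH t\<^sub>2 H s"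
abbreviation "ten_r \<equiv> pure_tensor A H t HH s\<^sub>2"
abbreviation "H_HH \<equiv> tensor_algebra A H t HH s\<^sub>2"

end

locale hopf_algebroid = hopf_algebroid_data +
  assumes s_map: "algebra_map K A H s"
    and t_map: "algebra_map K A H t"
    and \<Delta>_map: "algebra_map K H HH \<Delta>"
    and \<epsilon>_map: "algebra_map K H A \<epsilon>"
    and S_map: "algebra_map K H H S"
    and \<Delta>_left: "\<lbrakk>a \<in> carrier A; h \<in> carrier H\<rbrakk> \<Longrightarrow> \<Delta> (s a \<otimes>\<^bsub>H\<^esub> h) = s\<^sub>2 a \<otimes>\<^bsub>HH\<^esub> \<Delta> h"
    and \<Delta>_right: "\<lbrakk>a \<in> carrier A; h \<in> carrier H\<rbrakk> \<Longrightarrow> \<Delta> (h \<otimes>\<^bsub>H\<^esub> t a) = \<Delta> h \<otimes>\<^bsub>HH\<^esub> t\<^sub>2 a"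
    and \<epsilon>_left: "\<lbrakk>a \<in> carrier A; h \<in> carrier H\<rbrakk> \<Longrightarrow> \<epsilon> (s a \<otimes>\<^bsub>H\<^esub> h) = a \<otimes>\<^bsub>A\<^esub> \<epsilon> h"
    and \<epsilon>_right: "\<lbrakk>a \<in> carrier A; h \<in> carrier H\<rbrakk> \<Longrightarrow> \<epsilon> (h \<otimes>\<^bsub>H\<^esub> t a) = \<epsilon> h \<otimes>\<^bsub>A\<^esub> a"
    \<comment> \<open>\<open>(\<Delta> \<otimes> id) \<circ> \<Delta> = (id \<otimes> \<Delta>) \<circ> \<Delta>\<close> up to \<open>(u \<otimes> v) \<otimes> w \<mapsto> u \<otimes> (v \<otimes> w)\<close>\<close>
    and coassoc: "h \<in> carrier H \<Longrightarrow>
      tensor_lift (add_monoid H_HH)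
        (\<lambda>X w. tensor_lift (add_monoid H_HH) (\<lambda>u v. ten_r u (ten v w)) X)
        (tensor_lift (add_monoid HH_H) (\<lambda>x y. ten_l (\<Delta> x) y) (\<Delta> h))
      = tensor_lift (add_monoid H_HH) (\<lambda>x y. ten_r x (\<Delta> y)) (\<Delta> h)"
    and counit_left: "h \<in> carrier H \<Longrightarrow> tensor_lift (add_monoid H) (\<lambda>x y. s (\<epsilon> x) \<otimes>\<^bsub>H\<^esub> y) (\<Delta> h) = h"
    and counit_right: "h \<in> carrier H \<Longrightarrow> tensor_lift (add_monoid H) (\<lambda>x y. x \<otimes>\<^bsub>H\<^esub> t (\<epsilon> y)) (\<Delta> h) = h"
    and S_s: "a \<in> carrier A \<Longrightarrow> S (s a) = t a"
    and S_t: "a \<in> carrier A \<Longrightarrow> S (t a) = s a"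
    and S_S: "h \<in> carrier H \<Longrightarrow> S (S h) = h"
    and antipode_left: "h \<in> carrier H \<Longrightarrow>
      tensor_lift (add_monoid H) (\<lambda>x y. S x \<otimes>\<^bsub>H\<^esub> y) (\<Delta> h) = t (\<epsilon> h)"
    and antipode_right: "h \<in> carrier H \<Longrightarrow>
      tensor_lift (add_monoid H) (\<lambda>x y. x \<otimes>\<^bsub>H\<^esub> S y) (\<Delta> h) = s (\<epsilon> h)"

text \<open>
  Spaces of functions with pointwise operations. Functions on a carrier are represented by their
  extensional versions; the multiplicative fields of the record play no role.
\<close>

definition pointwise_module ::
  "'x set \<Rightarrow> ('k, 'm, 'd) module_scheme \<Rightarrow> ('x \<Rightarrow> 'm) set \<Rightarrow> ('k, 'x \<Rightarrow> 'm) module"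
  where "pointwise_module X M D =
    \<lparr>carrier = D, monoid.mult = undefined, one = undefined,
     ring.zero = (\<lambda>x\<in>X. \<zero>\<^bsub>M\<^esub>), ring.add = (\<lambda>f g. \<lambda>x\<in>X. f x \<oplus>\<^bsub>M\<^esub> g x),
     smult = (\<lambda>c f. \<lambda>x\<in>X. c \<odot>\<^bsub>M\<^esub> f x)\<rparr>"

definition pointwise_act :: "'x set \<Rightarrow> ('a, 'c) ring_scheme \<Rightarrow> 'a \<Rightarrow> ('x \<Rightarrow> 'a) \<Rightarrow> 'x \<Rightarrow> 'a"
  where "pointwise_act X A a f = (\<lambda>x\<in>X. a \<otimes>\<^bsub>A\<^esub> f x)"

text \<open>\<open>K\<close>-linear derivations \<open>B \<rightarrow> A\<close>, where \<open>B\<close> acts on \<open>A\<close> through \<open>e : B \<rightarrow> A\<close>.\<close>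

definition derivations_along ::
  "('k, 'c) ring_scheme \<Rightarrow> ('k, 'b, 'd) module_scheme \<Rightarrow> ('k, 'a, 'e) module_scheme \<Rightarrow> ('b \<Rightarrow> 'a) \<Rightarrow> ('b \<Rightarrow> 'a) set"
  where "derivations_along K B A e =
    {d \<in> carrier B \<rightarrow>\<^sub>E carrier A. linear_map K B A d \<and>
       (\<forall>u\<in>carrier B. \<forall>v\<in>carrier B.
          d (u \<otimes>\<^bsub>B\<^esub> v) = e u \<otimes>\<^bsub>A\<^esub> d v \<oplus>\<^bsub>A\<^esub> d u \<otimes>\<^bsub>A\<^esub> e v)}"

definition Der :: "('k, 'c) ring_scheme \<Rightarrow> ('k, 'a, 'd) module_scheme \<Rightarrow> ('k, 'a \<Rightarrow> 'a) module"
  where "Der K A = pointwise_module (carrier A) A (derivations_along K A A (\<lambda>a. a))"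

definition Der_bracket :: "('k, 'a, 'd) module_scheme \<Rightarrow> ('a \<Rightarrow> 'a) \<Rightarrow> ('a \<Rightarrow> 'a) \<Rightarrow> 'a \<Rightarrow> 'a"
  where "Der_bracket A D E = (\<lambda>a\<in>carrier A. D (E a) \<ominus>\<^bsub>A\<^esub> E (D a))"

locale lie_algebra = module K L
  for K :: "('k, 'c) ring_scheme" and L :: "('k, 'l, 'd) module_scheme" (structure) +
  fixes bracket :: "'l \<Rightarrow> 'l \<Rightarrow> 'l"
  assumes bracket_closed: "\<lbrakk>x \<in> carrier L; y \<in> carrier L\<rbrakk> \<Longrightarrow> bracket x y \<in> carrier L"
    and bracket_linear_left: "y \<in> carrier L \<Longrightarrow> linear_map K L L (\<lambda>x. bracket x y)"
    and bracket_linear_right: "x \<in> carrier L \<Longrightarrow> linear_map K L L (bracket x)"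
    and bracket_alternating: "x \<in> carrier L \<Longrightarrow> bracket x x = \<zero>"
    and jacobi: "\<lbrakk>x \<in> carrier L; y \<in> carrier L; z \<in> carrier L\<rbrakk> \<Longrightarrow>
      bracket x (bracket y z) \<oplus> bracket y (bracket z x) \<oplus> bracket z (bracket x y) = \<zero>"

text \<open>
  In a Lie--Rinehart algebra the Lie \<open>K\<close>-algebra and the \<open>A\<close>-module \<open>L\<close> have the same underlying
  \<open>K\<close>-module, which is \<open>act_scalar\<close>.
\<close>

locale lie_rinehart =
  A: algebra K A + L: lie_algebra K L bracket + LA: module A "with_smult L act"
  for K :: "('k, 'c) ring_scheme"
    and A :: "('k, 'a, 'd) module_scheme"
    and L :: "('k, 'l, 'e) module_scheme"
    and act :: "'a \<Rightarrow> 'l \<Rightarrow> 'l"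
    and bracket :: "'l \<Rightarrow> 'l \<Rightarrow> 'l" +
  fixes anchor :: "'l \<Rightarrow> 'a \<Rightarrow> 'a"
  assumes act_scalar: "\<lbrakk>c \<in> carrier K; a \<in> carrier A; X \<in> carrier L\<rbrakk> \<Longrightarrow>
      act (c \<odot>\<^bsub>A\<^esub> a) X = c \<odot>\<^bsub>L\<^esub> act a X"
    and anchor_linear: "linear_map K L (Der K A) anchor"
    and anchor_act_linear:
      "linear_map A (with_smult L act) (with_smult (Der K A) (pointwise_act (carrier A) A)) anchor"
    and anchor_bracket: "\<lbrakk>X \<in> carrier L; Y \<in> carrier L\<rbrakk> \<Longrightarrow>
      anchor (bracket X Y) = Der_bracket A (anchor X) (anchor Y)"
    and leibniz: "\<lbrakk>X \<in> carrier L; Y \<in> carrier L; a \<in> carrier A\<rbrakk> \<Longrightarrow>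
      bracket X (act a Y) = act a (bracket X Y) \<oplus>\<^bsub>L\<^esub> act (anchor X a) Y"

definition Der_s ::
  "('k, 'c) ring_scheme \<Rightarrow> ('k, 'a, 'd) module_scheme \<Rightarrow> ('k, 'h, 'e) module_scheme
     \<Rightarrow> ('a \<Rightarrow> 'h) \<Rightarrow> ('h \<Rightarrow> 'a) \<Rightarrow> ('k, 'h \<Rightarrow> 'a) module"
  where "Der_s K A H s \<epsilon> = pointwise_module (carrier H) A
    {\<delta> \<in> derivations_along K H A \<epsilon>. \<forall>a\<in>carrier A. \<delta> (s a) = \<zero>\<^bsub>A\<^esub>}"

definition Der_s_bracket ::
  "('k, 'a, 'd) module_scheme \<Rightarrow> ('k, 'h, 'e) module_scheme \<Rightarrow> ('a \<Rightarrow> 'h) \<Rightarrow> ('h \<Rightarrow> ('h \<times> 'h \<Rightarrow>\<^sub>0 int) set)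
     \<Rightarrow> ('h \<Rightarrow> 'a) \<Rightarrow> ('h \<Rightarrow> 'a) \<Rightarrow> 'h \<Rightarrow> 'a"
  where "Der_s_bracket A H t \<Delta> \<delta> \<delta>' = (\<lambda>u\<in>carrier H.
    tensor_lift (add_monoid A) (\<lambda>u\<^sub>1 u\<^sub>2. \<delta> (u\<^sub>1 \<otimes>\<^bsub>H\<^esub> t (\<delta>' u\<^sub>2))) (\<Delta> u) \<ominus>\<^bsub>A\<^esub>
    tensor_lift (add_monoid A) (\<lambda>u\<^sub>1 u\<^sub>2. \<delta>' (u\<^sub>1 \<otimes>\<^bsub>H\<^esub> t (\<delta> u\<^sub>2))) (\<Delta> u))"

definition Der_s_anchor :: "('k, 'a, 'd) module_scheme \<Rightarrow> ('a \<Rightarrow> 'h) \<Rightarrow> ('h \<Rightarrow> 'a) \<Rightarrow> 'a \<Rightarrow> 'a"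
  where "Der_s_anchor A t \<delta> = compose (carrier A) \<delta> t"

end

theory Submission
  imports Defs
begin

text \<open>
  A functional \<open>\<psi> : H \<rightarrow> A\<close> that is left \<open>A\<close>-linear (through \<open>s\<close>) determines an operator on \<open>H\<close>,
  \<open>R\<^sub>\<psi> u = u\<^sub>1 t(\<psi>(u\<^sub>2))\<close>, called \<open>invariant_op \<psi>\<close> below. It commutes with left multiplication by
  \<open>s(a)\<close>, and \<open>\<psi>\<close> is recovered from it as \<open>\<epsilon> \<circ> R\<^sub>\<psi>\<close> by the counit law. These are the left-invariant
  operators of the groupoid that \<open>H\<close> describes, and the bracket of the theorem is
  \<open>[\<delta>, \<delta>'] = \<delta> \<circ> R\<^sub>\<delta>\<^sub>' - \<delta>' \<circ> R\<^sub>\<delta>\<close>. So the heart of the matter is that left-invariant derivations are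
  closed under the commutator, and four facts carry the proof.

  Coassociativity gives \<open>R\<^sub>\<psi> \<circ> R\<^sub>\<chi> = R\<^sub>\<psi>\<^sub>\<circ>\<^sub>R\<^sub>\<chi>\<close> (\<open>invariant_op_comp\<close>), hence the operator of \<open>[\<delta>, \<delta>']\<close>
  is the commutator of \<open>R\<^sub>\<delta>\<close> and \<open>R\<^sub>\<delta>\<^sub>'\<close> (\<open>invariant_op_bracket\<close>), and the Jacobi identity is the one that
  holds for composition. Multiplicativity of \<open>\<Delta>\<close> makes \<open>R\<^sub>\<delta>\<close> a derivation of the ring \<open>H\<close> when \<open>\<delta>\<close> is
  a derivation along \<open>\<epsilon>\<close> (\<open>invariant_op_mult\<close>), so \<open>[\<delta>, \<delta>']\<close> is a derivation along \<open>\<epsilon>\<close>. From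
  \<open>\<Delta>(t a) = 1 \<otimes> t a\<close> one gets \<open>R\<^sub>\<delta>(t a) = t(\<delta>(t a))\<close> (\<open>invariant_op_t\<close>), so \<open>\<delta> \<mapsto> \<delta> \<circ> t\<close>
  preserves brackets. And \<open>R\<^sub>a\<^sub>\<delta> = t(a) R\<^sub>\<delta>\<close> (\<open>invariant_op_act\<close>) turns the derivation rule for
  \<open>\<delta>(t(a) R\<^sub>\<delta>\<^sub>' u)\<close> into the Leibniz rule with anchor term \<open>\<delta>(t a) \<delta>'(u)\<close>.

  The computations with \<open>u\<^sub>1 \<otimes> u\<^sub>2\<close> are all instances of one principle, the universal property of the
  tensor product: a group homomorphism can be moved inside a \<open>tensor_lift\<close>, where it has to be
  evaluated on pure tensors only (\<open>hom_lift\<close>).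
\<close>

section \<open>The universal property of the tensor product\<close>

text \<open>The target group is written multiplicatively, as in \<^const>\<open>tensor_lift\<close>; for a target ring it is
  the additive monoid.\<close>

definition balanced_map ::
  "('a, 'c) ring_scheme \<Rightarrow> ('p, 'd) ring_scheme \<Rightarrow> ('a \<Rightarrow> 'p) \<Rightarrow> ('q, 'e) ring_scheme \<Rightarrow> ('a \<Rightarrow> 'q)
     \<Rightarrow> ('g, 'f) monoid_scheme \<Rightarrow> ('p \<Rightarrow> 'q \<Rightarrow> 'g) \<Rightarrow> bool"
  where "balanced_map A P tP Q sQ G f \<longleftrightarrow>
    (\<forall>x\<in>carrier P. \<forall>y\<in>carrier Q. f x y \<in> carrier G) \<and>
    (\<forall>x\<in>carrier P. \<forall>x'\<in>carrier P. \<forall>y\<in>carrier Q. f (x \<oplus>\<^bsub>P\<^esub> x') y = f x y \<otimes>\<^bsub>G\<^esub> f x' y) \<and>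
    (\<forall>x\<in>carrier P. \<forall>y\<in>carrier Q. \<forall>y'\<in>carrier Q. f x (y \<oplus>\<^bsub>Q\<^esub> y') = f x y \<otimes>\<^bsub>G\<^esub> f x y') \<and>
    (\<forall>x\<in>carrier P. \<forall>a\<in>carrier A. \<forall>y\<in>carrier Q. f (x \<otimes>\<^bsub>P\<^esub> tP a) y = f x (sQ a \<otimes>\<^bsub>Q\<^esub> y))"

lemma balanced_mapI:
  assumes "\<And>x y. x \<in> carrier P \<Longrightarrow> y \<in> carrier Q \<Longrightarrow> f x y \<in> carrier G"
    and "\<And>x x' y. x \<in> carrier P \<Longrightarrow> x' \<in> carrier P \<Longrightarrow> y \<in> carrier Q \<Longrightarrow>
      f (x \<oplus>\<^bsub>P\<^esub> x') y = f x y \<otimes>\<^bsub>G\<^esub> f x' y"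
    and "\<And>x y y'. x \<in> carrier P \<Longrightarrow> y \<in> carrier Q \<Longrightarrow> y' \<in> carrier Q \<Longrightarrow>
      f x (y \<oplus>\<^bsub>Q\<^esub> y') = f x y \<otimes>\<^bsub>G\<^esub> f x y'"
    and "\<And>x a y. x \<in> carrier P \<Longrightarrow> a \<in> carrier A \<Longrightarrow> y \<in> carrier Q \<Longrightarrow>
      f (x \<otimes>\<^bsub>P\<^esub> tP a) y = f x (sQ a \<otimes>\<^bsub>Q\<^esub> y)"
  shows "balanced_map A P tP Q sQ G f"
  using assms unfolding balanced_map_def by blast

lemma balanced_mapD:
  assumes "balanced_map A P tP Q sQ G f"
  shows "\<And>x y. x \<in> carrier P \<Longrightarrow> y \<in> carrier Q \<Longrightarrow> f x y \<in> carrier G"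
    and "\<And>x x' y. x \<in> carrier P \<Longrightarrow> x' \<in> carrier P \<Longrightarrow> y \<in> carrier Q \<Longrightarrow>
      f (x \<oplus>\<^bsub>P\<^esub> x') y = f x y \<otimes>\<^bsub>G\<^esub> f x' y"
    and "\<And>x y y'. x \<in> carrier P \<Longrightarrow> y \<in> carrier Q \<Longrightarrow> y' \<in> carrier Q \<Longrightarrow>
      f x (y \<oplus>\<^bsub>Q\<^esub> y') = f x y \<otimes>\<^bsub>G\<^esub> f x y'"
    and "\<And>x a y. x \<in> carrier P \<Longrightarrow> a \<in> carrier A \<Longrightarrow> y \<in> carrier Q \<Longrightarrow>
      f (x \<otimes>\<^bsub>P\<^esub> tP a) y = f x (sQ a \<otimes>\<^bsub>Q\<^esub> y)"
  using assms unfolding balanced_map_def by blast+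

text \<open>The values of \<open>free_lift\<close> at two combinations and at their sum are products over different
  supports; they become comparable over a common finite superset.\<close>

lemma (in comm_group) free_lift_eq_finprod:
  assumes f: "\<And>p. p \<in> X \<Longrightarrow> f (fst p) (snd p) \<in> carrier G"
    and S: "finite S" "Poly_Mapping.keys c \<subseteq> S" "S \<subseteq> X"
  shows "free_lift G f c = finprod G (\<lambda>p. f (fst p) (snd p) [^] Poly_Mapping.lookup c p) S"
  unfolding free_lift_def
  using S f
  by (intro finprod_mono_neutral_cong_left)
     (auto simp: in_keys_iff int_pow_closed subset_iff)

lemma (in comm_group) free_lift_hom:
  assumes f: "\<And>p. p \<in> X \<Longrightarrow> f (fst p) (snd p) \<in> carrier G"
  shows "free_lift G f \<in> hom (free_Abelian_group X) G"
proof (rule homI)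
  fix c assume "c \<in> carrier (free_Abelian_group X)"
  then show "free_lift G f c \<in> carrier G"
    unfolding free_lift_def using f by (intro finprod_closed) (auto simp: int_pow_closed subset_iff)
next
  fix c d assume c: "c \<in> carrier (free_Abelian_group X)" and d: "d \<in> carrier (free_Abelian_group X)"
  let ?S = "Poly_Mapping.keys c \<union> Poly_Mapping.keys d"
  have S: "finite ?S" "?S \<subseteq> X"
    using c d by auto
  have fS: "\<And>p. p \<in> ?S \<Longrightarrow> f (fst p) (snd p) \<in> carrier G"
    using f S by blast
  have "free_lift G f (c + d) = finprod G (\<lambda>p. f (fst p) (snd p) [^] Poly_Mapping.lookup (c + d) p) ?S"
    using f S by (intro free_lift_eq_finprod[of X]) (simp_all add: keys_add)
  also have "\<dots> = finprod G (\<lambda>p. f (fst p) (snd p) [^] Poly_Mapping.lookup c p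
      \<otimes> f (fst p) (snd p) [^] Poly_Mapping.lookup d p) ?S"
    using fS by (intro finprod_cong') (auto simp: lookup_add int_pow_mult int_pow_closed)
  also have "\<dots> = finprod G (\<lambda>p. f (fst p) (snd p) [^] Poly_Mapping.lookup c p) ?S
      \<otimes> finprod G (\<lambda>p. f (fst p) (snd p) [^] Poly_Mapping.lookup d p) ?S"
    using fS by (intro finprod_multf) (auto simp: int_pow_closed)
  also have "\<dots> = free_lift G f c \<otimes> free_lift G f d"
    using f S by (simp add: free_lift_eq_finprod[of X f ?S])
  finally show "free_lift G f (c \<otimes>\<^bsub>free_Abelian_group X\<^esub> d) = free_lift G f c \<otimes> free_lift G f d"
    by simp
qed

lemma (in comm_group) free_lift_frag_of:
  assumes "f x y \<in> carrier G"
  shows "free_lift G f (frag_of (x, y)) = f x y"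
  using assms by (simp add: free_lift_def int_pow_1)

text \<open>The factors are additive groups with an action of \<open>A\<close>, so that a tensor product can itself be a
  factor as soon as its addition and the two actions are understood.\<close>

locale balanced_tensor = P: abelian_group P + Q: abelian_group Q
  for A :: "('a, 'c) ring_scheme"
    and P :: "('p, 'd) ring_scheme" and tP :: "'a \<Rightarrow> 'p"
    and Q :: "('q, 'e) ring_scheme" and sQ :: "'a \<Rightarrow> 'q" +
  assumes right_closed: "\<lbrakk>x \<in> carrier P; a \<in> carrier A\<rbrakk> \<Longrightarrow> x \<otimes>\<^bsub>P\<^esub> tP a \<in> carrier P"
    and left_closed: "\<lbrakk>y \<in> carrier Q; a \<in> carrier A\<rbrakk> \<Longrightarrow> sQ a \<otimes>\<^bsub>Q\<^esub> y \<in> carrier Q"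
begin

abbreviation "free \<equiv> free_Abelian_group (carrier P \<times> carrier Q)"
abbreviation "ker \<equiv> tensor_kernel A P tP Q sQ"
abbreviation "T \<equiv> tensor_group A P tP Q sQ"
abbreviation "pure \<equiv> pure_tensor A P tP Q sQ"
abbreviation "balanced \<equiv> balanced_map A P tP Q sQ"

lemma relations_closed: "tensor_relations A P tP Q sQ \<subseteq> carrier free"
proof -
  have diff: "c - d \<in> carrier free" if "c \<in> carrier free" "d \<in> carrier free" for c d
    using that keys_diff[of c d] by auto
  show ?thesis
    unfolding tensor_relations_def
    by (auto intro!: diff simp: right_closed left_closed simp del: carrier_free_Abelian_group_iff)
qed

lemma ker_subgroup: "subgroup ker free"
  unfolding tensor_kernel_def
  by (intro group.generate_is_subgroup relations_closed) simp

lemma ker_normal: "ker \<lhd> free"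
  using ker_subgroup abelian_free_Abelian_group comm_group.normal_iff_subgroup by blast

lemma T_comm_group: "comm_group T"
  unfolding tensor_group_def
  by (intro comm_group.abelian_FactGroup abelian_free_Abelian_group ker_subgroup)

lemma coset_hom: "(\<lambda>c. ker #>\<^bsub>free\<^esub> c) \<in> hom free T"
  unfolding tensor_group_def by (rule normal.r_coset_hom_Mod[OF ker_normal])

lemma carrier_T: "carrier T = (\<lambda>c. ker #>\<^bsub>free\<^esub> c) ` carrier free"
  unfolding tensor_group_def by (rule carrier_FactGroup)

lemma pure_closed [simp]: "\<lbrakk>x \<in> carrier P; y \<in> carrier Q\<rbrakk> \<Longrightarrow> pure x y \<in> carrier T"
  unfolding carrier_T pure_tensor_def by auto

text \<open>A homomorphism out of the free group that respects the defining relations is constant on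
  the cosets of the subgroup they generate, so the choice made by \<^const>\<open>tensor_lift\<close> does not
  matter.\<close>

lemma lift_coset:
  assumes G: "comm_group G" and f: "balanced G f" and c: "c \<in> carrier free"
  shows "tensor_lift G f (ker #>\<^bsub>free\<^esub> c) = free_lift G f c"
proof -
  interpret G: comm_group G by (rule G)
  have hom: "free_lift G f \<in> hom free G"
    by (rule G.free_lift_hom) (auto intro: balanced_mapD(1)[OF f])
  then interpret h: group_hom free G "free_lift G f"
    by (simp add: group_hom_def group_hom_axioms_def G.is_group)
  have diff: "free_lift G f (c - d) = free_lift G f c \<otimes>\<^bsub>G\<^esub> inv\<^bsub>G\<^esub> free_lift G f d"
    if "c \<in> carrier free" "d \<in> carrier free" for c d
  proof -
    have "free_lift G f (c \<otimes>\<^bsub>free\<^esub> inv\<^bsub>free\<^esub> d) = free_lift G f c \<otimes>\<^bsub>G\<^esub> inv\<^bsub>G\<^esub> free_lift G f d"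
      using that by (metis h.hom_inv h.hom_mult h.G.inv_closed)
    then show ?thesis using that by simp
  qed
  have cancel: "a \<otimes>\<^bsub>G\<^esub> b \<otimes>\<^bsub>G\<^esub> inv\<^bsub>G\<^esub> a \<otimes>\<^bsub>G\<^esub> inv\<^bsub>G\<^esub> b = \<one>\<^bsub>G\<^esub>" if "a \<in> carrier G" "b \<in> carrier G" for a b
    using that by (simp add: G.m_comm[of a b] G.m_assoc)
  have fr: "free_lift G f (frag_of (x, y)) = f x y" if "x \<in> carrier P" "y \<in> carrier Q" for x y
    using that by (intro G.free_lift_frag_of balanced_mapD(1)[OF f])
  have d2: "c - d \<in> carrier free" if "c \<in> carrier free" "d \<in> carrier free" for c d
    using that keys_diff[of c d] by auto
  have rel: "tensor_relations A P tP Q sQ \<subseteq> kernel free G (free_lift G f)"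
  proof
    fix r assume r: "r \<in> tensor_relations A P tP Q sQ"
    have "free_lift G f r = \<one>\<^bsub>G\<^esub>"
      using r unfolding tensor_relations_def
    proof (elim UnE CollectE exE conjE)
      fix x x' y assume "r = frag_of (x \<oplus>\<^bsub>P\<^esub> x', y) - frag_of (x, y) - frag_of (x', y)"
        and xy: "x \<in> carrier P" "x' \<in> carrier P" "y \<in> carrier Q"
      then have "free_lift G f r = (f x y \<otimes>\<^bsub>G\<^esub> f x' y) \<otimes>\<^bsub>G\<^esub> inv\<^bsub>G\<^esub> f x y \<otimes>\<^bsub>G\<^esub> inv\<^bsub>G\<^esub> f x' y"
        by (simp add: diff d2 fr balanced_mapD(2)[OF f] del: carrier_free_Abelian_group_iff)
      then show ?thesis
        using xy by (simp add: cancel balanced_mapD(1)[OF f])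
    next
      fix x y y' assume "r = frag_of (x, y \<oplus>\<^bsub>Q\<^esub> y') - frag_of (x, y) - frag_of (x, y')"
        and xy: "x \<in> carrier P" "y \<in> carrier Q" "y' \<in> carrier Q"
      then have "free_lift G f r = (f x y \<otimes>\<^bsub>G\<^esub> f x y') \<otimes>\<^bsub>G\<^esub> inv\<^bsub>G\<^esub> f x y \<otimes>\<^bsub>G\<^esub> inv\<^bsub>G\<^esub> f x y'"
        by (simp add: diff d2 fr balanced_mapD(3)[OF f] del: carrier_free_Abelian_group_iff)
      then show ?thesis
        using xy by (simp add: cancel balanced_mapD(1)[OF f])
    next
      fix x a y assume "r = frag_of (x \<otimes>\<^bsub>P\<^esub> tP a, y) - frag_of (x, sQ a \<otimes>\<^bsub>Q\<^esub> y)"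
        and xy: "x \<in> carrier P" "a \<in> carrier A" "y \<in> carrier Q"
      then have "free_lift G f r = f (x \<otimes>\<^bsub>P\<^esub> tP a) y \<otimes>\<^bsub>G\<^esub> inv\<^bsub>G\<^esub> f x (sQ a \<otimes>\<^bsub>Q\<^esub> y)"
        by (simp add: diff fr right_closed left_closed del: carrier_free_Abelian_group_iff)
      then show ?thesis
        using xy balanced_mapD(1)[OF f] by (simp add: balanced_mapD(4)[OF f] left_closed)
    qed
    then show "r \<in> kernel free G (free_lift G f)"
      using r relations_closed by (auto simp: kernel_def simp del: carrier_free_Abelian_group_iff)
  qed
  have ker: "ker \<subseteq> kernel free G (free_lift G f)"
    unfolding tensor_kernel_def
    by (intro group.generate_subgroup_incl rel h.subgroup_kernel) simp
  have const: "free_lift G f d = free_lift G f c" if d: "d \<in> ker #>\<^bsub>free\<^esub> c" for d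
  proof -
    obtain k where k: "k \<in> ker" "d = k \<otimes>\<^bsub>free\<^esub> c"
      using d unfolding r_coset_def by blast
    then have "k \<in> carrier free" "free_lift G f k = \<one>\<^bsub>G\<^esub>"
      using ker by (auto simp: kernel_def)
    then show ?thesis
      using k(2) h.hom_mult[OF _ c, of k] h.hom_closed[OF c] by simp
  qed
  have "c \<in> ker #>\<^bsub>free\<^esub> c"
    using c ker_subgroup by (intro group.rcos_self) auto
  then have "free_lift G f ` (ker #>\<^bsub>free\<^esub> c) = {free_lift G f c}"
    using const by blast
  then show ?thesis
    by (simp add: tensor_lift_def)
qed

lemma lift_hom:
  assumes G: "comm_group G" and f: "balanced G f"
  shows "tensor_lift G f \<in> hom T G"
proof (rule homI)
  interpret G: comm_group G by (rule G)
  have hom: "free_lift G f \<in> hom free G"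
    by (rule G.free_lift_hom) (auto intro: balanced_mapD(1)[OF f])
  show "tensor_lift G f X \<in> carrier G" if "X \<in> carrier T" for X
    using that hom unfolding carrier_T
    by (auto simp: lift_coset[OF G f] hom_def simp del: carrier_free_Abelian_group_iff)
  show "tensor_lift G f (X \<otimes>\<^bsub>T\<^esub> Y) = tensor_lift G f X \<otimes>\<^bsub>G\<^esub> tensor_lift G f Y"
    if XY: "X \<in> carrier T" "Y \<in> carrier T" for X Y
  proof -
    obtain c d where cd: "c \<in> carrier free" "d \<in> carrier free"
      and X: "X = ker #>\<^bsub>free\<^esub> c" and Y: "Y = ker #>\<^bsub>free\<^esub> d"
      using XY unfolding carrier_T by blast
    have cl: "c \<otimes>\<^bsub>free\<^esub> d \<in> carrier free"
      using cd by (intro monoid.m_closed group.is_monoid group_free_Abelian_group)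
    have "X \<otimes>\<^bsub>T\<^esub> Y = ker #>\<^bsub>free\<^esub> (c \<otimes>\<^bsub>free\<^esub> d)"
      unfolding X Y by (rule hom_mult[OF coset_hom cd, symmetric])
    then show ?thesis
      unfolding X Y using lift_coset[OF G f] cd cl hom_mult[OF hom cd] by metis
  qed
qed

lemma lift_closed:
  "\<lbrakk>comm_group G; balanced G f; X \<in> carrier T\<rbrakk> \<Longrightarrow> tensor_lift G f X \<in> carrier G"
  using lift_hom hom_in_carrier by metis

lemma lift_pure:
  assumes "comm_group G" "balanced G f" "x \<in> carrier P" "y \<in> carrier Q"
  shows "tensor_lift G f (pure x y) = f x y"
  using assms lift_coset[of G f "frag_of (x, y)"] comm_group.free_lift_frag_of[of G f x y]
    balanced_mapD(1)[of A P tP Q sQ G f x y]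
  by (simp add: pure_tensor_def)

text \<open>The pure tensors generate the group.\<close>

lemma hom_eqI:
  assumes G: "group G" and \<phi>: "\<phi> \<in> hom T G" and \<psi>: "\<psi> \<in> hom T G"
    and eq: "\<And>x y. x \<in> carrier P \<Longrightarrow> y \<in> carrier Q \<Longrightarrow> \<phi> (pure x y) = \<psi> (pure x y)"
    and X: "X \<in> carrier T"
  shows "\<phi> X = \<psi> X"
proof -
  let ?c = "\<lambda>c. ker #>\<^bsub>free\<^esub> c"
  have hc: "(\<lambda>c. \<chi> (?c c)) \<in> hom free G" if "\<chi> \<in> hom T G" for \<chi>
    using hom_compose[OF coset_hom that] by (simp add: comp_def)
  have "\<phi> (?c c) = \<psi> (?c c)" if "Poly_Mapping.keys c \<subseteq> carrier P \<times> carrier Q" for c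
  proof (rule free_Abelian_group_induct[where P = "\<lambda>c. \<phi> (?c c) = \<psi> (?c c)", OF that])
    show "\<phi> (?c 0) = \<psi> (?c 0)"
      using hom_one[OF hc[OF \<phi>] group_free_Abelian_group G] hom_one[OF hc[OF \<psi>] group_free_Abelian_group G]
      by simp
  next
    fix x y assume xy: "Poly_Mapping.keys x \<subseteq> carrier P \<times> carrier Q" "Poly_Mapping.keys y \<subseteq> carrier P \<times> carrier Q"
      and IH: "\<phi> (?c x) = \<psi> (?c x)" "\<phi> (?c y) = \<psi> (?c y)"
    have minus: "\<chi> (?c (x - y)) = \<chi> (?c x) \<otimes>\<^bsub>G\<^esub> inv\<^bsub>G\<^esub> \<chi> (?c y)" if "\<chi> \<in> hom T G" for \<chi>
    proof -
      interpret h: group_hom free G "\<lambda>c. \<chi> (?c c)"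
        using hc[OF that] G by (simp add: group_hom_def group_hom_axioms_def)
      have "\<chi> (?c (x \<otimes>\<^bsub>free\<^esub> inv\<^bsub>free\<^esub> y)) = \<chi> (?c x) \<otimes>\<^bsub>G\<^esub> inv\<^bsub>G\<^esub> \<chi> (?c y)"
        using xy by (metis h.hom_inv h.hom_mult h.G.inv_closed carrier_free_Abelian_group_iff)
      then show ?thesis using xy by simp
    qed
    show "\<phi> (?c (x - y)) = \<psi> (?c (x - y))"
      unfolding minus[OF \<phi>] minus[OF \<psi>] IH ..
  next
    fix p assume "p \<in> carrier P \<times> carrier Q"
    then show "\<phi> (?c (frag_of p)) = \<psi> (?c (frag_of p))"
      using eq[of "fst p" "snd p"] by (auto simp: pure_tensor_def)
  qed
  then show ?thesis
    using X unfolding carrier_T by auto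
qed

text \<open>The form in which the universal property is used throughout: to rewrite a homomorphic image of
  an expression in \<open>u\<^sub>1\<close> and \<open>u\<^sub>2\<close> it suffices to rewrite it on pure tensors. The right-hand function
  \<open>g\<close> inherits balancedness from \<open>f\<close>.\<close>

lemma hom_lift:
  assumes G: "comm_group G" and G': "comm_group G'" and \<phi>: "\<phi> \<in> hom G G'"
    and f: "balanced G f" and X: "X \<in> carrier T"
    and eq: "\<And>x y. \<lbrakk>x \<in> carrier P; y \<in> carrier Q\<rbrakk> \<Longrightarrow> \<phi> (f x y) = g x y"
  shows "\<phi> (tensor_lift G f X) = tensor_lift G' g X"
proof -
  have g: "balanced G' g"
    using \<phi>
    by (intro balanced_mapI)
       (simp_all flip: eq add: balanced_mapD[OF f] right_closed left_closed hom_in_carrier hom_mult)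
  have "(\<phi> \<circ> tensor_lift G f) X = tensor_lift G' g X"
  proof (rule hom_eqI[OF _ _ _ _ X])
    show "group G'" using G' by (rule comm_group.axioms)
    show "\<phi> \<circ> tensor_lift G f \<in> hom T G'"
      by (rule hom_compose[OF lift_hom[OF G f] \<phi>])
  qed (simp_all add: lift_pure[OF G f] lift_pure[OF G' g] lift_hom[OF G' g] eq)
  then show ?thesis by simp
qed

lemma lift_cong:
  assumes G: "comm_group G" and f: "balanced G f" and X: "X \<in> carrier T"
    and eq: "\<And>x y. x \<in> carrier P \<Longrightarrow> y \<in> carrier Q \<Longrightarrow> f x y = g x y"
  shows "tensor_lift G f X = tensor_lift G g X"
  using hom_lift[OF G G _ f X, of "\<lambda>x. x" g] eq by (simp add: hom_def)

lemma lift_mult: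
  assumes G: "comm_group G" and f: "balanced G f" and g: "balanced G g" and X: "X \<in> carrier T"
  shows "tensor_lift G (\<lambda>x y. f x y \<otimes>\<^bsub>G\<^esub> g x y) X = tensor_lift G f X \<otimes>\<^bsub>G\<^esub> tensor_lift G g X"
proof -
  interpret G: comm_group G by (rule G)
  have four: "(a \<otimes>\<^bsub>G\<^esub> b) \<otimes>\<^bsub>G\<^esub> (c \<otimes>\<^bsub>G\<^esub> d) = (a \<otimes>\<^bsub>G\<^esub> c) \<otimes>\<^bsub>G\<^esub> (b \<otimes>\<^bsub>G\<^esub> d)"
    if "a \<in> carrier G" "b \<in> carrier G" "c \<in> carrier G" "d \<in> carrier G" for a b c d
    using that by (simp add: G.m_ac)
  have fg: "balanced G (\<lambda>x y. f x y \<otimes>\<^bsub>G\<^esub> g x y)"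
    using balanced_mapD[OF f] balanced_mapD[OF g] by (intro balanced_mapI) (simp_all add: four)
  have hom: "(\<lambda>X. tensor_lift G f X \<otimes>\<^bsub>G\<^esub> tensor_lift G g X) \<in> hom T G"
    by (intro homI)
       (simp_all add: lift_closed[OF G f] lift_closed[OF G g] hom_mult[OF lift_hom[OF G f]]
         hom_mult[OF lift_hom[OF G g]] four)
  show ?thesis
    by (rule hom_eqI[OF G.is_group lift_hom[OF G fg] hom _ X])
       (simp add: lift_pure[OF G f] lift_pure[OF G g] lift_pure[OF G fg])
qed

lemma pure_balanced: "balanced T pure"
proof (rule balanced_mapI)
  interpret T: comm_group T by (rule T_comm_group)
  interpret h: group_hom free T "\<lambda>c. ker #>\<^bsub>free\<^esub> c"
    using coset_hom by (simp add: group_hom_def group_hom_axioms_def T.is_group)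
  have one: "ker #>\<^bsub>free\<^esub> r = \<one>\<^bsub>T\<^esub>" if "r \<in> tensor_relations A P tP Q sQ" for r
  proof -
    have "r \<in> ker" unfolding tensor_kernel_def by (rule generate.incl[OF that])
    then show ?thesis
      using subgroup.rcos_const[OF ker_subgroup] by (simp add: tensor_group_def)
  qed
  have eqI: "ker #>\<^bsub>free\<^esub> c = ker #>\<^bsub>free\<^esub> d"
    if "c \<in> carrier free" "d \<in> carrier free" "c - d \<in> tensor_relations A P tP Q sQ" for c d
  proof -
    have "c = (c - d) \<otimes>\<^bsub>free\<^esub> d" by simp
    then have "ker #>\<^bsub>free\<^esub> c = (ker #>\<^bsub>free\<^esub> (c - d)) \<otimes>\<^bsub>T\<^esub> (ker #>\<^bsub>free\<^esub> d)"
      using that relations_closed h.hom_mult[of "c - d" d] by auto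
    then show ?thesis
      using one[OF that(3)] h.hom_closed[OF that(2)] by simp
  qed
  have sum: "ker #>\<^bsub>free\<^esub> (c + d) = (ker #>\<^bsub>free\<^esub> c) \<otimes>\<^bsub>T\<^esub> (ker #>\<^bsub>free\<^esub> d)"
      "c + d \<in> carrier free"
    if "c \<in> carrier free" "d \<in> carrier free" for c d
    using h.hom_mult[OF that] h.G.m_closed[OF that] by simp_all
  show "pure x y \<in> carrier T" if "x \<in> carrier P" "y \<in> carrier Q" for x y
    using that by simp
  show "pure (x \<oplus>\<^bsub>P\<^esub> x') y = pure x y \<otimes>\<^bsub>T\<^esub> pure x' y"
    if "x \<in> carrier P" "x' \<in> carrier P" "y \<in> carrier Q" for x x' y
  proof -
    have "ker #>\<^bsub>free\<^esub> frag_of (x \<oplus>\<^bsub>P\<^esub> x', y) = ker #>\<^bsub>free\<^esub> (frag_of (x, y) + frag_of (x', y))"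
    proof (rule eqI)
      show "frag_of (x \<oplus>\<^bsub>P\<^esub> x', y) - (frag_of (x, y) + frag_of (x', y)) \<in> tensor_relations A P tP Q sQ"
        unfolding tensor_relations_def diff_diff_add[symmetric] using that by blast
    qed (use that in \<open>simp_all add: sum del: carrier_free_Abelian_group_iff\<close>)
    then show ?thesis using that by (simp add: pure_tensor_def sum del: carrier_free_Abelian_group_iff)
  qed
  show "pure x (y \<oplus>\<^bsub>Q\<^esub> y') = pure x y \<otimes>\<^bsub>T\<^esub> pure x y'"
    if "x \<in> carrier P" "y \<in> carrier Q" "y' \<in> carrier Q" for x y y'
  proof -
    have "ker #>\<^bsub>free\<^esub> frag_of (x, y \<oplus>\<^bsub>Q\<^esub> y') = ker #>\<^bsub>free\<^esub> (frag_of (x, y) + frag_of (x, y'))"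
    proof (rule eqI)
      show "frag_of (x, y \<oplus>\<^bsub>Q\<^esub> y') - (frag_of (x, y) + frag_of (x, y')) \<in> tensor_relations A P tP Q sQ"
        unfolding tensor_relations_def diff_diff_add[symmetric] using that by blast
    qed (use that in \<open>simp_all add: sum del: carrier_free_Abelian_group_iff\<close>)
    then show ?thesis using that by (simp add: pure_tensor_def sum del: carrier_free_Abelian_group_iff)
  qed
  show "pure (x \<otimes>\<^bsub>P\<^esub> tP a) y = pure x (sQ a \<otimes>\<^bsub>Q\<^esub> y)"
    if "x \<in> carrier P" "a \<in> carrier A" "y \<in> carrier Q" for x a y
    unfolding pure_tensor_def
  proof (rule eqI)
    show "frag_of (x \<otimes>\<^bsub>P\<^esub> tP a, y) - frag_of (x, sQ a \<otimes>\<^bsub>Q\<^esub> y) \<in> tensor_relations A P tP Q sQ"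
      unfolding tensor_relations_def using that by blast
  qed (use that in \<open>simp_all add: right_closed left_closed\<close>)
qed

end

section \<open>The product on \<open>H \<otimes>\<^sub>A H\<close>\<close>

text \<open>The group \<^const>\<open>tensor_group\<close> and the additive monoid of \<^const>\<open>tensor_algebra\<close> have the same
  operations but differ as records in their extension field; this transfers the group laws.\<close>

lemma (in comm_group) comm_group_change_extension:
  "comm_group \<lparr>carrier = carrier G, monoid.mult = monoid.mult G, one = \<one>, \<dots> = z\<rparr>"
  by (rule comm_groupI) (auto simp: m_ac intro: l_inv)

context hopf_algebroid
begin

lemma s_closed [simp]: "a \<in> carrier A \<Longrightarrow> s a \<in> carrier H"
  and s_add: "\<lbrakk>a \<in> carrier A; b \<in> carrier A\<rbrakk> \<Longrightarrow> s (a \<oplus>\<^bsub>A\<^esub> b) = s a \<oplus>\<^bsub>H\<^esub> s b"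
  and s_mult: "\<lbrakk>a \<in> carrier A; b \<in> carrier A\<rbrakk> \<Longrightarrow> s (a \<otimes>\<^bsub>A\<^esub> b) = s a \<otimes>\<^bsub>H\<^esub> s b"
  and s_one [simp]: "s \<one>\<^bsub>A\<^esub> = \<one>\<^bsub>H\<^esub>"
  using s_map by (auto simp: algebra_map_def ring_hom_def)

lemma s_smult: "\<lbrakk>c \<in> carrier K; a \<in> carrier A\<rbrakk> \<Longrightarrow> s (c \<odot>\<^bsub>A\<^esub> a) = c \<odot>\<^bsub>H\<^esub> s a"
  using s_map by (auto simp: algebra_map_def linear_map_def)

lemma t_closed [simp]: "a \<in> carrier A \<Longrightarrow> t a \<in> carrier H"
  and t_add: "\<lbrakk>a \<in> carrier A; b \<in> carrier A\<rbrakk> \<Longrightarrow> t (a \<oplus>\<^bsub>A\<^esub> b) = t a \<oplus>\<^bsub>H\<^esub> t b"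
  and t_mult: "\<lbrakk>a \<in> carrier A; b \<in> carrier A\<rbrakk> \<Longrightarrow> t (a \<otimes>\<^bsub>A\<^esub> b) = t a \<otimes>\<^bsub>H\<^esub> t b"
  and t_one [simp]: "t \<one>\<^bsub>A\<^esub> = \<one>\<^bsub>H\<^esub>"
  using t_map by (auto simp: algebra_map_def ring_hom_def)

lemma t_smult: "\<lbrakk>c \<in> carrier K; a \<in> carrier A\<rbrakk> \<Longrightarrow> t (c \<odot>\<^bsub>A\<^esub> a) = c \<odot>\<^bsub>H\<^esub> t a"
  using t_map by (auto simp: algebra_map_def linear_map_def)

lemma \<epsilon>_closed [simp]: "u \<in> carrier H \<Longrightarrow> \<epsilon> u \<in> carrier A"
  and \<epsilon>_add: "\<lbrakk>u \<in> carrier H; v \<in> carrier H\<rbrakk> \<Longrightarrow> \<epsilon> (u \<oplus>\<^bsub>H\<^esub> v) = \<epsilon> u \<oplus>\<^bsub>A\<^esub> \<epsilon> v"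
  and \<epsilon>_mult: "\<lbrakk>u \<in> carrier H; v \<in> carrier H\<rbrakk> \<Longrightarrow> \<epsilon> (u \<otimes>\<^bsub>H\<^esub> v) = \<epsilon> u \<otimes>\<^bsub>A\<^esub> \<epsilon> v"
  and \<epsilon>_one [simp]: "\<epsilon> \<one>\<^bsub>H\<^esub> = \<one>\<^bsub>A\<^esub>"
  using \<epsilon>_map by (auto simp: algebra_map_def ring_hom_def)

lemma \<epsilon>_s [simp]: "a \<in> carrier A \<Longrightarrow> \<epsilon> (s a) = a"
  using \<epsilon>_left[of a "\<one>\<^bsub>H\<^esub>"] by simp

lemma \<epsilon>_t [simp]: "a \<in> carrier A \<Longrightarrow> \<epsilon> (t a) = a"
  using \<epsilon>_right[of a "\<one>\<^bsub>H\<^esub>"] by simp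

lemma A_add_group: "comm_group (add_monoid A)"
  by (rule A.M.a_comm_group)

lemma H_add_group: "comm_group (add_monoid H)"
  by (rule H.M.a_comm_group)

sublocale HH: balanced_tensor A H t H s
  by unfold_locales simp_all

lemma HH_simps [simp]:
  "carrier HH = carrier HH.T" "ring.add HH = monoid.mult HH.T" "\<zero>\<^bsub>HH\<^esub> = \<one>\<^bsub>HH.T\<^esub>" "\<one>\<^bsub>HH\<^esub> = ten \<one>\<^bsub>H\<^esub> \<one>\<^bsub>H\<^esub>"
  by (simp_all add: tensor_algebra_def Let_def)

lemma HH_mult: "X \<otimes>\<^bsub>HH\<^esub> Y = tensor_lift HH.T (\<lambda>x y. tensor_lift HH.T
    (\<lambda>x' y'. ten (x \<otimes>\<^bsub>H\<^esub> x') (y \<otimes>\<^bsub>H\<^esub> y')) Y) X"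
  by (simp add: tensor_algebra_def Let_def)

lemma \<Delta>_closed [simp]: "u \<in> carrier H \<Longrightarrow> \<Delta> u \<in> carrier HH.T"
  and \<Delta>_add: "\<lbrakk>u \<in> carrier H; v \<in> carrier H\<rbrakk> \<Longrightarrow> \<Delta> (u \<oplus>\<^bsub>H\<^esub> v) = \<Delta> u \<otimes>\<^bsub>HH.T\<^esub> \<Delta> v"
  and \<Delta>_mult: "\<lbrakk>u \<in> carrier H; v \<in> carrier H\<rbrakk> \<Longrightarrow> \<Delta> (u \<otimes>\<^bsub>H\<^esub> v) = \<Delta> u \<otimes>\<^bsub>HH\<^esub> \<Delta> v"
  and \<Delta>_one: "\<Delta> \<one>\<^bsub>H\<^esub> = ten \<one>\<^bsub>H\<^esub> \<one>\<^bsub>H\<^esub>"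
  using \<Delta>_map by (auto simp: algebra_map_def ring_hom_def)

text \<open>The product of \<open>H \<otimes>\<^sub>A H\<close> is defined by two nested lifts. They can be evaluated because the
  inner function is balanced for fixed \<open>x, y\<close>, and its lift is balanced in \<open>x, y\<close>; both rest on
  commutativity of \<open>H\<close>.\<close>

lemma HH_mult_inner_balanced:
  assumes x: "x \<in> carrier H" and y: "y \<in> carrier H"
  shows "HH.balanced HH.T (\<lambda>x' y'. ten (x \<otimes>\<^bsub>H\<^esub> x') (y \<otimes>\<^bsub>H\<^esub> y'))"
proof (rule balanced_mapI)
  note pb = balanced_mapD[OF HH.pure_balanced]
  fix u a v assume uv: "u \<in> carrier H" "a \<in> carrier A" "v \<in> carrier H"
  have "ten (x \<otimes>\<^bsub>H\<^esub> (u \<otimes>\<^bsub>H\<^esub> t a)) (y \<otimes>\<^bsub>H\<^esub> v) = ten ((x \<otimes>\<^bsub>H\<^esub> u) \<otimes>\<^bsub>H\<^esub> t a) (y \<otimes>\<^bsub>H\<^esub> v)"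
    using uv x by (simp add: H.m_assoc)
  also have "\<dots> = ten (x \<otimes>\<^bsub>H\<^esub> u) (s a \<otimes>\<^bsub>H\<^esub> (y \<otimes>\<^bsub>H\<^esub> v))"
    using uv x y by (simp add: pb(4))
  also have "s a \<otimes>\<^bsub>H\<^esub> (y \<otimes>\<^bsub>H\<^esub> v) = y \<otimes>\<^bsub>H\<^esub> (s a \<otimes>\<^bsub>H\<^esub> v)"
    using uv y by (simp add: H.m_lcomm)
  finally show "ten (x \<otimes>\<^bsub>H\<^esub> (u \<otimes>\<^bsub>H\<^esub> t a)) (y \<otimes>\<^bsub>H\<^esub> v) = ten (x \<otimes>\<^bsub>H\<^esub> u) (y \<otimes>\<^bsub>H\<^esub> (s a \<otimes>\<^bsub>H\<^esub> v))" .
qed (use x y in \<open>simp_all add: H.r_distr balanced_mapD(2,3)[OF HH.pure_balanced]\<close>)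

lemma HH_mult_outer_balanced:
  assumes Y: "Y \<in> carrier HH.T"
  shows "HH.balanced HH.T (\<lambda>x y. tensor_lift HH.T (\<lambda>x' y'. ten (x \<otimes>\<^bsub>H\<^esub> x') (y \<otimes>\<^bsub>H\<^esub> y')) Y)"
proof (rule balanced_mapI)
  note pb = balanced_mapD[OF HH.pure_balanced]
  let ?f = "\<lambda>x y x' y'. ten (x \<otimes>\<^bsub>H\<^esub> x') (y \<otimes>\<^bsub>H\<^esub> y')"
  note bal = HH_mult_inner_balanced
  note TG = HH.T_comm_group
  show "tensor_lift HH.T (?f x y) Y \<in> carrier HH.T" if "x \<in> carrier H" "y \<in> carrier H" for x y
    using HH.lift_closed[OF TG bal[OF that] Y] .
  show "tensor_lift HH.T (?f (x \<oplus>\<^bsub>H\<^esub> z) y) Y = tensor_lift HH.T (?f x y) Y \<otimes>\<^bsub>HH.T\<^esub> tensor_lift HH.T (?f z y) Y"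
    if xy: "x \<in> carrier H" "z \<in> carrier H" "y \<in> carrier H" for x z y
  proof -
    have "tensor_lift HH.T (?f (x \<oplus>\<^bsub>H\<^esub> z) y) Y = tensor_lift HH.T (\<lambda>x' y'. ?f x y x' y' \<otimes>\<^bsub>HH.T\<^esub> ?f z y x' y') Y"
      using xy by (intro HH.lift_cong[OF TG bal Y]) (simp_all add: H.l_distr pb(2))
    then show ?thesis
      using xy by (simp add: HH.lift_mult[OF TG bal bal Y])
  qed
  show "tensor_lift HH.T (?f x (y \<oplus>\<^bsub>H\<^esub> z)) Y = tensor_lift HH.T (?f x y) Y \<otimes>\<^bsub>HH.T\<^esub> tensor_lift HH.T (?f x z) Y"
    if xy: "x \<in> carrier H" "y \<in> carrier H" "z \<in> carrier H" for x y z
  proof -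
    have "tensor_lift HH.T (?f x (y \<oplus>\<^bsub>H\<^esub> z)) Y = tensor_lift HH.T (\<lambda>x' y'. ?f x y x' y' \<otimes>\<^bsub>HH.T\<^esub> ?f x z x' y') Y"
      using xy by (intro HH.lift_cong[OF TG bal Y]) (simp_all add: H.l_distr pb(3))
    then show ?thesis
      using xy by (simp add: HH.lift_mult[OF TG bal bal Y])
  qed
  show "tensor_lift HH.T (?f (x \<otimes>\<^bsub>H\<^esub> t a) y) Y = tensor_lift HH.T (?f x (s a \<otimes>\<^bsub>H\<^esub> y)) Y"
    if xy: "x \<in> carrier H" "a \<in> carrier A" "y \<in> carrier H" for x a y
  proof (rule HH.lift_cong[OF TG bal Y])
    fix u v assume uv: "u \<in> carrier H" "v \<in> carrier H"
    have "(x \<otimes>\<^bsub>H\<^esub> t a) \<otimes>\<^bsub>H\<^esub> u = (x \<otimes>\<^bsub>H\<^esub> u) \<otimes>\<^bsub>H\<^esub> t a"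
      using xy uv by (simp add: H.m_ac)
    moreover have "ten ((x \<otimes>\<^bsub>H\<^esub> u) \<otimes>\<^bsub>H\<^esub> t a) (y \<otimes>\<^bsub>H\<^esub> v) = ten (x \<otimes>\<^bsub>H\<^esub> u) (s a \<otimes>\<^bsub>H\<^esub> (y \<otimes>\<^bsub>H\<^esub> v))"
      using xy uv by (simp add: pb(4))
    ultimately show "?f (x \<otimes>\<^bsub>H\<^esub> t a) y u v = ?f x (s a \<otimes>\<^bsub>H\<^esub> y) u v"
      using xy uv by (simp only: H.m_assoc s_closed)
  qed (use xy in simp_all)
qed

lemma HH_mult_closed:
  assumes "X \<in> carrier HH.T" "Y \<in> carrier HH.T"
  shows "X \<otimes>\<^bsub>HH\<^esub> Y \<in> carrier HH.T"
  unfolding HH_mult using assms by (intro HH.lift_closed HH.T_comm_group HH_mult_outer_balanced)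

text \<open>The left and right actions of \<open>A\<close> on \<open>H \<otimes>\<^sub>A H\<close>, as they occur in the \<open>A\<close>-bilinearity of \<open>\<Delta>\<close>.\<close>

lemma s2_mult:
  assumes a: "a \<in> carrier A" and Y: "Y \<in> carrier HH.T"
  shows "s\<^sub>2 a \<otimes>\<^bsub>HH\<^esub> Y = tensor_lift HH.T (\<lambda>x y. ten (s a \<otimes>\<^bsub>H\<^esub> x) y) Y"
proof -
  have "s\<^sub>2 a \<otimes>\<^bsub>HH\<^esub> Y = tensor_lift HH.T (\<lambda>x y. ten (s a \<otimes>\<^bsub>H\<^esub> x) (\<one>\<^bsub>H\<^esub> \<otimes>\<^bsub>H\<^esub> y)) Y"
    unfolding HH_mult using a by (simp add: HH.lift_pure[OF HH.T_comm_group HH_mult_outer_balanced[OF Y]])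
  also have "\<dots> = tensor_lift HH.T (\<lambda>x y. ten (s a \<otimes>\<^bsub>H\<^esub> x) y) Y"
    using a by (intro HH.lift_cong[OF HH.T_comm_group HH_mult_inner_balanced Y]) simp_all
  finally show ?thesis .
qed

lemma mult_t2:
  assumes a: "a \<in> carrier A" and X: "X \<in> carrier HH.T"
  shows "X \<otimes>\<^bsub>HH\<^esub> t\<^sub>2 a = tensor_lift HH.T (\<lambda>x y. ten x (y \<otimes>\<^bsub>H\<^esub> t a)) X"
  unfolding HH_mult
  using a by (intro HH.lift_cong[OF HH.T_comm_group HH_mult_outer_balanced X])
     (simp_all add: HH.lift_pure[OF HH.T_comm_group HH_mult_inner_balanced])

lemma s2_mult_pure:
  "\<lbrakk>a \<in> carrier A; x \<in> carrier H; y \<in> carrier H\<rbrakk> \<Longrightarrow> s\<^sub>2 a \<otimes>\<^bsub>HH\<^esub> ten x y = ten (s a \<otimes>\<^bsub>H\<^esub> x) y"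
  unfolding HH_mult
  by (simp add: HH.lift_pure[OF HH.T_comm_group HH_mult_outer_balanced]
      HH.lift_pure[OF HH.T_comm_group HH_mult_inner_balanced])

lemma HH_abelian_group: "abelian_group HH"
proof (rule abelian_group.intro[OF _ abelian_group_axioms.intro])
  have "comm_group (add_monoid HH)"
    using comm_group.comm_group_change_extension[OF HH.T_comm_group] by simp
  then show "comm_group (add_monoid HH)" .
  then show "abelian_monoid HH"
    by (simp add: abelian_monoid_def comm_group.axioms)
qed

sublocale H_HH: balanced_tensor A H t HH s\<^sub>2
proof -
  interpret HH': abelian_group HH by (rule HH_abelian_group)
  show "balanced_tensor A H t HH s\<^sub>2"
    by unfold_locales (simp_all add: HH_mult_closed)
qed

sublocale HH_H: balanced_tensor A HH t\<^sub>2 H s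
proof -
  interpret HH': abelian_group HH by (rule HH_abelian_group)
  show "balanced_tensor A HH t\<^sub>2 H s"
    by unfold_locales (simp_all add: HH_mult_closed)
qed

section \<open>Left-invariant operators\<close>

definition left_linear where
  "left_linear \<psi> \<longleftrightarrow>
    (\<forall>u\<in>carrier H. \<psi> u \<in> carrier A) \<and>
    (\<forall>u\<in>carrier H. \<forall>v\<in>carrier H. \<psi> (u \<oplus>\<^bsub>H\<^esub> v) = \<psi> u \<oplus>\<^bsub>A\<^esub> \<psi> v) \<and>
    (\<forall>a\<in>carrier A. \<forall>u\<in>carrier H. \<psi> (s a \<otimes>\<^bsub>H\<^esub> u) = a \<otimes>\<^bsub>A\<^esub> \<psi> u)"

lemma left_linearD:
  assumes "left_linear \<psi>"
  shows left_linear_closed: "\<And>u. u \<in> carrier H \<Longrightarrow> \<psi> u \<in> carrier A"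
    and left_linear_add: "\<And>u v. \<lbrakk>u \<in> carrier H; v \<in> carrier H\<rbrakk> \<Longrightarrow> \<psi> (u \<oplus>\<^bsub>H\<^esub> v) = \<psi> u \<oplus>\<^bsub>A\<^esub> \<psi> v"
    and left_linear_s: "\<And>a u. \<lbrakk>a \<in> carrier A; u \<in> carrier H\<rbrakk> \<Longrightarrow> \<psi> (s a \<otimes>\<^bsub>H\<^esub> u) = a \<otimes>\<^bsub>A\<^esub> \<psi> u"
  using assms unfolding left_linear_def by blast+

lemma left_linear_\<epsilon>: "left_linear \<epsilon>"
  unfolding left_linear_def by (simp add: \<epsilon>_add \<epsilon>_left)

lemma left_linear_hom: "left_linear \<psi> \<Longrightarrow> \<psi> \<in> hom (add_monoid H) (add_monoid A)"
  by (intro homI) (simp_all add: left_linearD)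

text \<open>The map \<open>id \<otimes> \<psi> : H \<otimes>\<^sub>A H \<rightarrow> H \<otimes>\<^sub>A A = H\<close>, where \<open>A\<close> acts on \<open>H\<close> from the right through \<open>t\<close>.\<close>

definition contract where
  "contract \<psi> = tensor_lift (add_monoid H) (\<lambda>x y. x \<otimes>\<^bsub>H\<^esub> t (\<psi> y))"

definition invariant_op where
  "invariant_op \<psi> u = contract \<psi> (\<Delta> u)"

lemma contract_balanced:
  assumes "left_linear \<psi>"
  shows "HH.balanced (add_monoid H) (\<lambda>x y. x \<otimes>\<^bsub>H\<^esub> t (\<psi> y))"
  by (rule balanced_mapI)
     (simp_all add: left_linearD[OF assms] H.l_distr H.r_distr t_add t_mult H.m_assoc)

lemma contract_hom: "left_linear \<psi> \<Longrightarrow> contract \<psi> \<in> hom HH.T (add_monoid H)"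
  unfolding contract_def by (intro HH.lift_hom H_add_group contract_balanced)

lemma contract_closed [simp]: "\<lbrakk>left_linear \<psi>; X \<in> carrier HH.T\<rbrakk> \<Longrightarrow> contract \<psi> X \<in> carrier H"
  using hom_in_carrier[OF contract_hom] by simp

lemma contract_add: "\<lbrakk>left_linear \<psi>; X \<in> carrier HH.T; Y \<in> carrier HH.T\<rbrakk> \<Longrightarrow>
    contract \<psi> (X \<otimes>\<^bsub>HH.T\<^esub> Y) = contract \<psi> X \<oplus>\<^bsub>H\<^esub> contract \<psi> Y"
  using hom_mult[OF contract_hom] by simp

lemma contract_pure: "\<lbrakk>left_linear \<psi>; x \<in> carrier H; y \<in> carrier H\<rbrakk> \<Longrightarrow>
    contract \<psi> (ten x y) = x \<otimes>\<^bsub>H\<^esub> t (\<psi> y)"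
  unfolding contract_def by (intro HH.lift_pure H_add_group contract_balanced)

lemma H_mult_hom: "c \<in> carrier H \<Longrightarrow> (\<lambda>x. c \<otimes>\<^bsub>H\<^esub> x) \<in> hom (add_monoid H) (add_monoid H)"
  by (intro homI) (simp_all add: H.r_distr)

lemma contract_s2:
  assumes \<psi>: "left_linear \<psi>" and a: "a \<in> carrier A" and Y: "Y \<in> carrier HH.T"
  shows "contract \<psi> (s\<^sub>2 a \<otimes>\<^bsub>HH\<^esub> Y) = s a \<otimes>\<^bsub>H\<^esub> contract \<psi> Y"
proof -
  have bal: "HH.balanced HH.T (\<lambda>x y. ten (s a \<otimes>\<^bsub>H\<^esub> x) y)"
    using a by (intro balanced_mapI)
      (simp_all add: H.r_distr balanced_mapD(2,3)[OF HH.pure_balanced] balanced_mapD(4)[OF HH.pure_balanced]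
        flip: H.m_assoc)
  have sa: "s a \<in> carrier H" using a by simp
  have "contract \<psi> (s\<^sub>2 a \<otimes>\<^bsub>HH\<^esub> Y)
      = tensor_lift (add_monoid H) (\<lambda>x y. s a \<otimes>\<^bsub>H\<^esub> (x \<otimes>\<^bsub>H\<^esub> t (\<psi> y))) Y"
    unfolding s2_mult[OF a Y] using a
    by (intro HH.hom_lift[OF HH.T_comm_group H_add_group contract_hom[OF \<psi>] bal Y])
       (simp add: contract_pure \<psi> left_linearD[OF \<psi>] H.m_assoc)
  also have "\<dots> = s a \<otimes>\<^bsub>H\<^esub> contract \<psi> Y"
    unfolding contract_def
    by (rule HH.hom_lift[OF H_add_group H_add_group H_mult_hom[OF sa] contract_balanced[OF \<psi>] Y refl, symmetric])
  finally show ?thesis .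
qed

lemma t2_balanced: "a \<in> carrier A \<Longrightarrow> HH.balanced HH.T (\<lambda>x y. ten x (y \<otimes>\<^bsub>H\<^esub> t a))"
  by (rule balanced_mapI)
     (simp_all add: H.l_distr balanced_mapD(2,3)[OF HH.pure_balanced] balanced_mapD(4)[OF HH.pure_balanced]
        H.m_assoc)

lemma contract_t2:
  assumes \<psi>: "left_linear \<psi>" and a: "a \<in> carrier A" and X: "X \<in> carrier HH.T"
  shows "contract \<psi> (X \<otimes>\<^bsub>HH\<^esub> t\<^sub>2 a)
    = tensor_lift (add_monoid H) (\<lambda>x y. x \<otimes>\<^bsub>H\<^esub> t (\<psi> (y \<otimes>\<^bsub>H\<^esub> t a))) X"
  unfolding mult_t2[OF a X] using a
  by (intro HH.hom_lift[OF HH.T_comm_group H_add_group contract_hom[OF \<psi>] t2_balanced[OF a] X])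
     (simp add: contract_pure \<psi>)

lemma invariant_op_closed [simp]: "\<lbrakk>left_linear \<psi>; u \<in> carrier H\<rbrakk> \<Longrightarrow> invariant_op \<psi> u \<in> carrier H"
  by (simp add: invariant_op_def)

lemma invariant_op_add: "\<lbrakk>left_linear \<psi>; u \<in> carrier H; v \<in> carrier H\<rbrakk> \<Longrightarrow>
    invariant_op \<psi> (u \<oplus>\<^bsub>H\<^esub> v) = invariant_op \<psi> u \<oplus>\<^bsub>H\<^esub> invariant_op \<psi> v"
  by (simp add: invariant_op_def \<Delta>_add contract_add)

lemma invariant_op_s: "\<lbrakk>left_linear \<psi>; a \<in> carrier A; u \<in> carrier H\<rbrakk> \<Longrightarrow>
    invariant_op \<psi> (s a \<otimes>\<^bsub>H\<^esub> u) = s a \<otimes>\<^bsub>H\<^esub> invariant_op \<psi> u"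
  by (simp add: invariant_op_def \<Delta>_left contract_s2)

lemma invariant_op_t:
  assumes "left_linear \<psi>" "a \<in> carrier A"
  shows "invariant_op \<psi> (t a) = t (\<psi> (t a))"
proof -
  have "\<Delta> (t a) = ten \<one>\<^bsub>H\<^esub> \<one>\<^bsub>H\<^esub> \<otimes>\<^bsub>HH\<^esub> t\<^sub>2 a"
    using \<Delta>_right[of a "\<one>\<^bsub>H\<^esub>"] assms by (simp add: \<Delta>_one)
  also have "\<dots> = ten \<one>\<^bsub>H\<^esub> (t a)"
    using assms by (simp add: mult_t2 HH.lift_pure[OF HH.T_comm_group t2_balanced])
  finally show ?thesis
    using assms by (simp add: invariant_op_def contract_pure left_linear_closed)
qed

lemma invariant_op_\<epsilon>: "u \<in> carrier H \<Longrightarrow> invariant_op \<epsilon> u = u"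
  using counit_right by (simp add: invariant_op_def contract_def)

lemma left_linear_invariant_op:
  "\<lbrakk>left_linear \<phi>; left_linear \<psi>\<rbrakk> \<Longrightarrow> left_linear (\<lambda>u. \<phi> (invariant_op \<psi> u))"
  unfolding left_linear_def[of "\<lambda>u. \<phi> (invariant_op \<psi> u)"]
  by (simp add: left_linearD invariant_op_add invariant_op_s)

text \<open>A functional is determined by its operator: \<open>\<epsilon>(u\<^sub>1 t(\<psi> u\<^sub>2)) = \<epsilon>(u\<^sub>1) \<psi>(u\<^sub>2) = \<psi>(s(\<epsilon> u\<^sub>1) u\<^sub>2)\<close>,
  and \<open>s(\<epsilon> u\<^sub>1) u\<^sub>2 = u\<close>.\<close>

lemma \<epsilon>_invariant_op:
  assumes \<psi>: "left_linear \<psi>" and u: "u \<in> carrier H"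
  shows "\<epsilon> (invariant_op \<psi> u) = \<psi> u"
proof -
  have bal: "HH.balanced (add_monoid H) (\<lambda>x y. s (\<epsilon> x) \<otimes>\<^bsub>H\<^esub> y)"
    by (rule balanced_mapI)
       (simp_all add: \<epsilon>_add \<epsilon>_mult s_add s_mult H.l_distr H.r_distr H.m_assoc)
  have "\<epsilon> (invariant_op \<psi> u) = tensor_lift (add_monoid A) (\<lambda>x y. \<psi> (s (\<epsilon> x) \<otimes>\<^bsub>H\<^esub> y)) (\<Delta> u)"
    unfolding invariant_op_def contract_def using u
    by (intro HH.hom_lift[OF H_add_group A_add_group left_linear_hom[OF left_linear_\<epsilon>]
        contract_balanced[OF \<psi>]]) (simp_all add: \<epsilon>_mult left_linearD[OF \<psi>])
  also have "\<dots> = \<psi> (tensor_lift (add_monoid H) (\<lambda>x y. s (\<epsilon> x) \<otimes>\<^bsub>H\<^esub> y) (\<Delta> u))"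
    by (rule HH.hom_lift[OF H_add_group A_add_group left_linear_hom[OF \<psi>] bal _ refl, symmetric])
       (simp add: u)
  also have "\<dots> = \<psi> u"
    using counit_left u by simp
  finally show ?thesis .
qed

text \<open>This identifies the two terms in the definition of the bracket.\<close>

lemma tensor_lift_invariant_op:
  assumes "left_linear \<phi>" "left_linear \<psi>" "u \<in> carrier H"
  shows "tensor_lift (add_monoid A) (\<lambda>x y. \<phi> (x \<otimes>\<^bsub>H\<^esub> t (\<psi> y))) (\<Delta> u) = \<phi> (invariant_op \<psi> u)"
  unfolding invariant_op_def contract_def
  by (rule HH.hom_lift[OF H_add_group A_add_group left_linear_hom contract_balanced _ refl, symmetric])
     (simp_all add: assms)

text \<open>Both sides are \<open>u\<^sub>1 t(\<psi>(u\<^sub>2 t(\<chi> u\<^sub>3)))\<close>. Let \<open>\<Phi>\<close> be the homomorphism on \<open>H \<otimes> (H \<otimes> H)\<close> that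
  sends \<open>x \<otimes> Y\<close> to \<open>x t(\<psi>((id \<otimes> \<chi>) Y))\<close>. The right-hand side is \<open>\<Phi>\<close> applied to
  \<open>(id \<otimes> \<Delta>) (\<Delta> u)\<close>. The left-hand side is \<open>\<Theta>\<close> applied to \<open>(\<Delta> \<otimes> id) (\<Delta> u)\<close>, where \<open>\<Theta>\<close> is
  \<open>\<Phi>\<close> preceded by the reassociation map; this uses \<open>\<Delta>(x t(\<chi> y)) = \<Delta>(x) t\<^sub>2(\<chi> y)\<close>.\<close>

lemma invariant_op_comp:
  assumes \<psi>: "left_linear \<psi>" and \<chi>: "left_linear \<chi>" and u: "u \<in> carrier H"
  shows "invariant_op \<psi> (invariant_op \<chi> u) = invariant_op (\<lambda>v. \<psi> (invariant_op \<chi> v)) u"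
proof -
  note \<psi>D = left_linearD[OF \<psi>] and \<chi>D = left_linearD[OF \<chi>]
  have H_HH_group: "comm_group (add_monoid H_HH)" and HH_H_group: "comm_group (add_monoid HH_H)"
    using comm_group.comm_group_change_extension[OF H_HH.T_comm_group]
      comm_group.comm_group_change_extension[OF HH_H.T_comm_group]
    by (simp_all add: tensor_algebra_def Let_def)
  have car: "carrier (add_monoid H_HH) = carrier H_HH.T" "monoid.mult (add_monoid H_HH) = monoid.mult H_HH.T"
      "carrier (add_monoid HH_H) = carrier HH_H.T" "monoid.mult (add_monoid HH_H) = monoid.mult HH_H.T"
    by (simp_all add: tensor_algebra_def Let_def)
  let ?f = "\<lambda>x Y. x \<otimes>\<^bsub>H\<^esub> t (\<psi> (contract \<chi> Y))"
  define \<Phi> where "\<Phi> = tensor_lift (add_monoid H) ?f"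
  have f_bal: "H_HH.balanced (add_monoid H) ?f"
    by (rule balanced_mapI)
       (simp_all add: \<chi> \<psi>D contract_add contract_s2 H.l_distr H.r_distr H.m_assoc t_add t_mult)
  have \<Phi>_hom: "\<Phi> \<in> hom (add_monoid H_HH) (add_monoid H)"
    using H_HH.lift_hom[OF H_add_group f_bal] unfolding \<Phi>_def hom_def car by simp
  have \<Phi>_pure: "\<Phi> (ten_r x Y) = ?f x Y" if "x \<in> carrier H" "Y \<in> carrier HH.T" for x Y
    unfolding \<Phi>_def using that by (simp add: H_HH.lift_pure[OF H_add_group f_bal])
  note pb = balanced_mapD[OF HH.pure_balanced]
    and rb = balanced_mapD[OF H_HH.pure_balanced, simplified]
    and lb = balanced_mapD[OF HH_H.pure_balanced, simplified]
  have r_bal: "HH.balanced (add_monoid H_HH) (\<lambda>x y. ten_r x (\<Delta> y))"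
    unfolding balanced_map_def car by (simp add: \<Delta>_add \<Delta>_left rb(2,3,4) H_HH.pure_closed)
  have right: "\<Phi> (tensor_lift (add_monoid H_HH) (\<lambda>x y. ten_r x (\<Delta> y)) (\<Delta> u))
      = invariant_op (\<lambda>v. \<psi> (invariant_op \<chi> v)) u"
    unfolding invariant_op_def[of "\<lambda>v. \<psi> (invariant_op \<chi> v)"] contract_def[of "\<lambda>v. \<psi> (invariant_op \<chi> v)"]
    using u by (intro HH.hom_lift[OF H_HH_group H_add_group \<Phi>_hom r_bal])
      (simp_all add: \<Phi>_pure invariant_op_def)
  \<comment> \<open>\<open>?G X w\<close> is the reassociated \<open>X \<otimes> w\<close>.\<close>
  let ?g = "\<lambda>w x y. ten_r x (ten y w)"
  let ?G = "\<lambda>X w. tensor_lift (add_monoid H_HH) (?g w) X"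
  have g_bal: "HH.balanced (add_monoid H_HH) (?g w)" if w: "w \<in> carrier H" for w
    using w unfolding balanced_map_def car by (simp add: rb pb(2,3) s2_mult_pure H_HH.pure_closed)
  have G_bal: "HH_H.balanced (add_monoid H_HH) ?G"
  proof (rule balanced_mapI)
    fix X w assume "X \<in> carrier HH" and w: "w \<in> carrier H"
    then have X: "X \<in> carrier HH.T" by simp
    show "?G X w \<in> carrier (add_monoid H_HH)"
      by (rule HH.lift_closed[OF H_HH_group g_bal[OF w] X])
    fix X' assume "X' \<in> carrier HH"
    then show "?G (X \<oplus>\<^bsub>HH\<^esub> X') w = ?G X w \<otimes>\<^bsub>add_monoid H_HH\<^esub> ?G X' w"
      using hom_mult[OF HH.lift_hom[OF H_HH_group g_bal[OF w]] X] by simp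
  next
    fix X w w' assume "X \<in> carrier HH" and w: "w \<in> carrier H" "w' \<in> carrier H"
    then have X: "X \<in> carrier HH.T" by simp
    have "?G X (w \<oplus>\<^bsub>H\<^esub> w') = tensor_lift (add_monoid H_HH) (\<lambda>x y. ?g w x y \<otimes>\<^bsub>add_monoid H_HH\<^esub> ?g w' x y) X"
      using w by (intro HH.lift_cong[OF H_HH_group g_bal X]) (simp_all add: car pb(3) rb(3) del: monoid.simps)
    then show "?G X (w \<oplus>\<^bsub>H\<^esub> w') = ?G X w \<otimes>\<^bsub>add_monoid H_HH\<^esub> ?G X w'"
      unfolding HH.lift_mult[OF H_HH_group g_bal[OF w(1)] g_bal[OF w(2)] X] .
  next
    fix X a w assume "X \<in> carrier HH" and a: "a \<in> carrier A" and w: "w \<in> carrier H"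
    then have X: "X \<in> carrier HH.T" by simp
    show "?G (X \<otimes>\<^bsub>HH\<^esub> t\<^sub>2 a) w = ?G X (s a \<otimes>\<^bsub>H\<^esub> w)"
      unfolding mult_t2[OF a X]
    proof (rule HH.hom_lift[OF HH.T_comm_group H_HH_group _ t2_balanced[OF a] X])
      show "tensor_lift (add_monoid H_HH) (?g w) \<in> hom HH.T (add_monoid H_HH)"
        by (rule HH.lift_hom[OF H_HH_group g_bal[OF w]])
      fix x y assume "x \<in> carrier H" "y \<in> carrier H"
      then show "?G (ten x (y \<otimes>\<^bsub>H\<^esub> t a)) w = ?g (s a \<otimes>\<^bsub>H\<^esub> w) x y"
        using a w by (simp add: HH.lift_pure[OF H_HH_group g_bal] pb(4))
    qed
  qed
  have l_bal: "HH.balanced (add_monoid HH_H) (\<lambda>x y. ten_l (\<Delta> x) y)"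
    unfolding balanced_map_def car by (simp add: \<Delta>_add \<Delta>_right lb HH_H.pure_closed)
  define \<Theta> where "\<Theta> Z = \<Phi> (tensor_lift (add_monoid H_HH) ?G Z)" for Z
  have \<Theta>_hom: "\<Theta> \<in> hom (add_monoid HH_H) (add_monoid H)"
    using hom_compose[OF HH_H.lift_hom[OF H_HH_group G_bal] \<Phi>_hom]
    unfolding \<Theta>_def comp_def hom_def car by simp
  have \<Theta>_pure: "\<Theta> (ten_l X w) = contract \<psi> (X \<otimes>\<^bsub>HH\<^esub> t\<^sub>2 (\<chi> w))"
    if X: "X \<in> carrier HH.T" and w: "w \<in> carrier H" for X w
  proof -
    have "\<Theta> (ten_l X w) = \<Phi> (?G X w)"
      using X w by (simp add: \<Theta>_def HH_H.lift_pure[OF H_HH_group G_bal])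
    also have "\<dots> = tensor_lift (add_monoid H) (\<lambda>x y. x \<otimes>\<^bsub>H\<^esub> t (\<psi> (y \<otimes>\<^bsub>H\<^esub> t (\<chi> w)))) X"
      using w by (intro HH.hom_lift[OF H_HH_group H_add_group \<Phi>_hom g_bal[OF w] X])
        (simp add: \<Phi>_pure contract_pure \<chi>)
    also have "\<dots> = contract \<psi> (X \<otimes>\<^bsub>HH\<^esub> t\<^sub>2 (\<chi> w))"
      by (simp add: contract_t2 \<psi> X \<chi>D w)
    finally show ?thesis .
  qed
  have op_hom: "invariant_op \<psi> \<in> hom (add_monoid H) (add_monoid H)"
    by (intro homI) (simp_all add: \<psi> invariant_op_add)
  have "invariant_op \<psi> (invariant_op \<chi> u)
      = tensor_lift (add_monoid H) (\<lambda>x y. contract \<psi> (\<Delta> x \<otimes>\<^bsub>HH\<^esub> t\<^sub>2 (\<chi> y))) (\<Delta> u)"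
    unfolding invariant_op_def[of \<chi>] contract_def[of \<chi>] using u
    by (intro HH.hom_lift[OF H_add_group H_add_group op_hom contract_balanced[OF \<chi>]])
       (simp_all add: invariant_op_def \<Delta>_right \<chi>D)
  also have "\<dots> = \<Theta> (tensor_lift (add_monoid HH_H) (\<lambda>x y. ten_l (\<Delta> x) y) (\<Delta> u))"
    using u by (intro HH.hom_lift[OF HH_H_group H_add_group \<Theta>_hom l_bal, symmetric])
      (simp_all add: \<Theta>_pure)
  also have "\<dots> = \<Phi> (tensor_lift (add_monoid H_HH) (\<lambda>x y. ten_r x (\<Delta> y)) (\<Delta> u))"
    unfolding \<Theta>_def by (simp only: coassoc[OF u])
  also note right
  finally show ?thesis .
qed

section \<open>Derivations along the counit\<close>

definition "derivation_s = {\<delta> \<in> derivations_along K H A \<epsilon>. \<forall>a\<in>carrier A. \<delta> (s a) = \<zero>\<^bsub>A\<^esub>}"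

lemma derivation_s_mult:
  "\<lbrakk>\<delta> \<in> derivation_s; u \<in> carrier H; v \<in> carrier H\<rbrakk> \<Longrightarrow>
    \<delta> (u \<otimes>\<^bsub>H\<^esub> v) = \<epsilon> u \<otimes>\<^bsub>A\<^esub> \<delta> v \<oplus>\<^bsub>A\<^esub> \<delta> u \<otimes>\<^bsub>A\<^esub> \<epsilon> v"
  by (simp add: derivation_s_def derivations_along_def)

text \<open>Since \<open>\<epsilon>(s a) = a\<close>, a derivation along \<open>\<epsilon>\<close> that vanishes on \<open>s\<close> is left \<open>A\<close>-linear.\<close>

lemma derivation_s_left_linear:
  assumes "\<delta> \<in> derivation_s"
  shows "left_linear \<delta>"
proof -
  have "\<delta> \<in> carrier H \<rightarrow> carrier A"
    "\<forall>x\<in>carrier H. \<forall>y\<in>carrier H. \<delta> (x \<oplus>\<^bsub>H\<^esub> y) = \<delta> x \<oplus>\<^bsub>A\<^esub> \<delta> y"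
    "\<forall>a\<in>carrier A. \<delta> (s a) = \<zero>\<^bsub>A\<^esub>"
    using assms by (auto simp: derivation_s_def derivations_along_def linear_map_def)
  then show ?thesis
    by (auto simp: left_linear_def derivation_s_mult[OF assms] Pi_iff)
qed

text \<open>On pure tensors, \<open>x x' t(\<delta>(y y'))\<close> expands to
  \<open>x t(\<epsilon> y) \<cdot> x' t(\<delta> y') + x t(\<delta> y) \<cdot> x' t(\<epsilon> y')\<close>; the two nested lifts of the product are then
  evaluated one after the other. With \<open>X = \<Delta> u\<close> and \<open>Y = \<Delta> v\<close> the factors with \<open>\<epsilon>\<close> collapse to \<open>u\<close> and
  \<open>v\<close>.\<close>

lemma contract_mult:
  assumes \<delta>: "\<delta> \<in> derivation_s" and X: "X \<in> carrier HH.T" and Y: "Y \<in> carrier HH.T"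
  shows "contract \<delta> (X \<otimes>\<^bsub>HH\<^esub> Y)
    = contract \<epsilon> X \<otimes>\<^bsub>H\<^esub> contract \<delta> Y \<oplus>\<^bsub>H\<^esub> contract \<delta> X \<otimes>\<^bsub>H\<^esub> contract \<epsilon> Y"
proof -
  note ll = derivation_s_left_linear[OF \<delta>] and \<epsilon>l = left_linear_\<epsilon>
  note dl = left_linearD[OF ll]
  let ?g = "\<lambda>x y x' y'. ten (x \<otimes>\<^bsub>H\<^esub> x') (y \<otimes>\<^bsub>H\<^esub> y')"
  let ?p = "\<lambda>\<psi> x y. x \<otimes>\<^bsub>H\<^esub> t (\<psi> y)"
  have mult_bal: "HH.balanced (add_monoid H) (\<lambda>x y. c \<otimes>\<^bsub>H\<^esub> f x y)"
      "HH.balanced (add_monoid H) (\<lambda>x y. f x y \<otimes>\<^bsub>H\<^esub> c)"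
      if "c \<in> carrier H" "HH.balanced (add_monoid H) f" for c f
    using balanced_mapD[OF that(2)] that(1)
    by (auto intro!: balanced_mapI simp: H.r_distr H.l_distr)
  have lift_c: "tensor_lift (add_monoid H) (\<lambda>x y. c \<otimes>\<^bsub>H\<^esub> ?p \<psi> x y) Z = c \<otimes>\<^bsub>H\<^esub> contract \<psi> Z"
      "tensor_lift (add_monoid H) (\<lambda>x y. ?p \<psi> x y \<otimes>\<^bsub>H\<^esub> c) Z = contract \<psi> Z \<otimes>\<^bsub>H\<^esub> c"
    if c: "c \<in> carrier H" and \<psi>: "left_linear \<psi>" and Z: "Z \<in> carrier HH.T" for c \<psi> Z
  proof -
    show *: "tensor_lift (add_monoid H) (\<lambda>x y. c \<otimes>\<^bsub>H\<^esub> ?p \<psi> x y) Z = c \<otimes>\<^bsub>H\<^esub> contract \<psi> Z"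
      unfolding contract_def
      by (rule HH.hom_lift[OF H_add_group H_add_group H_mult_hom[OF c] contract_balanced[OF \<psi>] Z refl, symmetric])
    have "tensor_lift (add_monoid H) (\<lambda>x y. ?p \<psi> x y \<otimes>\<^bsub>H\<^esub> c) Z
        = tensor_lift (add_monoid H) (\<lambda>x y. c \<otimes>\<^bsub>H\<^esub> ?p \<psi> x y) Z"
      using c \<psi> by (intro HH.lift_cong[OF H_add_group mult_bal(2)[OF c contract_balanced[OF \<psi>]] Z])
        (simp add: H.m_comm left_linear_closed)
    then show "tensor_lift (add_monoid H) (\<lambda>x y. ?p \<psi> x y \<otimes>\<^bsub>H\<^esub> c) Z = contract \<psi> Z \<otimes>\<^bsub>H\<^esub> c"
      using * c \<psi> Z by (simp add: H.m_comm)
  qed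
  have inner: "contract \<delta> (tensor_lift HH.T (?g x y) Y)
      = ?p \<epsilon> x y \<otimes>\<^bsub>H\<^esub> contract \<delta> Y \<oplus>\<^bsub>H\<^esub> ?p \<delta> x y \<otimes>\<^bsub>H\<^esub> contract \<epsilon> Y"
    if xy: "x \<in> carrier H" "y \<in> carrier H" for x y
  proof -
    note gb = HH_mult_inner_balanced[OF xy]
    have px: "?p \<epsilon> x y \<in> carrier H" "?p \<delta> x y \<in> carrier H"
      using xy by (simp_all add: dl)
    have "contract \<delta> (tensor_lift HH.T (?g x y) Y) = tensor_lift (add_monoid H)
        (\<lambda>x' y'. (?p \<epsilon> x y \<otimes>\<^bsub>H\<^esub> ?p \<delta> x' y') \<otimes>\<^bsub>add_monoid H\<^esub> (?p \<delta> x y \<otimes>\<^bsub>H\<^esub> ?p \<epsilon> x' y')) Y"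
    proof (rule HH.hom_lift[OF HH.T_comm_group H_add_group contract_hom[OF ll] gb Y])
      fix x' y' assume xy': "x' \<in> carrier H" "y' \<in> carrier H"
      have "contract \<delta> (?g x y x' y')
          = (x \<otimes>\<^bsub>H\<^esub> x') \<otimes>\<^bsub>H\<^esub> (t (\<epsilon> y) \<otimes>\<^bsub>H\<^esub> t (\<delta> y') \<oplus>\<^bsub>H\<^esub> t (\<delta> y) \<otimes>\<^bsub>H\<^esub> t (\<epsilon> y'))"
        using xy xy' by (simp add: contract_pure ll derivation_s_mult[OF \<delta>] t_add t_mult dl)
      also have "\<dots> = ?p \<epsilon> x y \<otimes>\<^bsub>H\<^esub> ?p \<delta> x' y' \<oplus>\<^bsub>H\<^esub> ?p \<delta> x y \<otimes>\<^bsub>H\<^esub> ?p \<epsilon> x' y'"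
        using xy xy' by (simp add: H.r_distr H.m_ac dl)
      finally show "contract \<delta> (?g x y x' y')
          = (?p \<epsilon> x y \<otimes>\<^bsub>H\<^esub> ?p \<delta> x' y') \<otimes>\<^bsub>add_monoid H\<^esub> (?p \<delta> x y \<otimes>\<^bsub>H\<^esub> ?p \<epsilon> x' y')"
        by simp
    qed
    also have "\<dots> = ?p \<epsilon> x y \<otimes>\<^bsub>H\<^esub> contract \<delta> Y \<oplus>\<^bsub>H\<^esub> ?p \<delta> x y \<otimes>\<^bsub>H\<^esub> contract \<epsilon> Y"
      using HH.lift_mult[OF H_add_group mult_bal(1)[OF px(1) contract_balanced[OF ll]]
          mult_bal(1)[OF px(2) contract_balanced[OF \<epsilon>l]] Y]
      by (simp add: lift_c(1)[OF px(1) ll Y] lift_c(1)[OF px(2) \<epsilon>l Y])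
    finally show ?thesis .
  qed
  have cY: "contract \<delta> Y \<in> carrier H" "contract \<epsilon> Y \<in> carrier H"
    using Y ll \<epsilon>l by simp_all
  have "contract \<delta> (X \<otimes>\<^bsub>HH\<^esub> Y) = tensor_lift (add_monoid H)
      (\<lambda>x y. (?p \<epsilon> x y \<otimes>\<^bsub>H\<^esub> contract \<delta> Y) \<otimes>\<^bsub>add_monoid H\<^esub> (?p \<delta> x y \<otimes>\<^bsub>H\<^esub> contract \<epsilon> Y)) X"
    unfolding HH_mult
    by (rule HH.hom_lift[OF HH.T_comm_group H_add_group contract_hom[OF ll] HH_mult_outer_balanced[OF Y] X])
       (simp add: inner)
  also have "\<dots> = contract \<epsilon> X \<otimes>\<^bsub>H\<^esub> contract \<delta> Y \<oplus>\<^bsub>H\<^esub> contract \<delta> X \<otimes>\<^bsub>H\<^esub> contract \<epsilon> Y"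
    using HH.lift_mult[OF H_add_group mult_bal(2)[OF cY(1) contract_balanced[OF \<epsilon>l]]
        mult_bal(2)[OF cY(2) contract_balanced[OF ll]] X]
    by (simp add: lift_c(2)[OF cY(1) \<epsilon>l X] lift_c(2)[OF cY(2) ll X])
  finally show ?thesis .
qed

lemma invariant_op_mult:
  assumes "\<delta> \<in> derivation_s" "u \<in> carrier H" "v \<in> carrier H"
  shows "invariant_op \<delta> (u \<otimes>\<^bsub>H\<^esub> v) = u \<otimes>\<^bsub>H\<^esub> invariant_op \<delta> v \<oplus>\<^bsub>H\<^esub> invariant_op \<delta> u \<otimes>\<^bsub>H\<^esub> v"
  using assms contract_mult[OF assms(1), of "\<Delta> u" "\<Delta> v"] invariant_op_\<epsilon>
  by (simp add: invariant_op_def \<Delta>_mult)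

end

section \<open>Modules of functions\<close>

lemma pointwise_module_simps [simp]:
  "carrier (pointwise_module X M D) = D"
  "\<zero>\<^bsub>pointwise_module X M D\<^esub> = (\<lambda>x\<in>X. \<zero>\<^bsub>M\<^esub>)"
  "f \<oplus>\<^bsub>pointwise_module X M D\<^esub> g = (\<lambda>x\<in>X. f x \<oplus>\<^bsub>M\<^esub> g x)"
  "c \<odot>\<^bsub>pointwise_module X M D\<^esub> f = (\<lambda>x\<in>X. c \<odot>\<^bsub>M\<^esub> f x)"
  by (simp_all add: pointwise_module_def)

lemma with_smult_simps [simp]:
  "carrier (with_smult M act) = carrier M"
  "\<zero>\<^bsub>with_smult M act\<^esub> = \<zero>\<^bsub>M\<^esub>"
  "x \<oplus>\<^bsub>with_smult M act\<^esub> y = x \<oplus>\<^bsub>M\<^esub> y"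
  "a \<odot>\<^bsub>with_smult M act\<^esub> x = act a x"
  by (simp_all add: with_smult_def)

lemma with_smult_abelian_group:
  assumes "abelian_group M"
  shows "abelian_group (with_smult M act)"
proof -
  interpret M: abelian_group M by (rule assms)
  show ?thesis
    by (rule abelian_groupI) (auto simp: M.a_ac intro: M.l_neg)
qed

text \<open>Stated for any record with the pointwise operations, so that it applies both to the \<open>K\<close>-module
  and to the \<open>A\<close>-module of derivations. Negatives are obtained as \<open>(-1) f\<close>.\<close>

lemma (in module) function_module:
  assumes D: "D \<subseteq> X \<rightarrow>\<^sub>E carrier M"
    and zero: "(\<lambda>x\<in>X. \<zero>\<^bsub>M\<^esub>) \<in> D"
    and add: "\<And>f g. \<lbrakk>f \<in> D; g \<in> D\<rbrakk> \<Longrightarrow> (\<lambda>x\<in>X. f x \<oplus>\<^bsub>M\<^esub> g x) \<in> D"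
    and smult: "\<And>c f. \<lbrakk>c \<in> carrier R; f \<in> D\<rbrakk> \<Longrightarrow> (\<lambda>x\<in>X. c \<odot>\<^bsub>M\<^esub> f x) \<in> D"
    and L: "carrier L = D" "\<zero>\<^bsub>L\<^esub> = (\<lambda>x\<in>X. \<zero>\<^bsub>M\<^esub>)"
      "\<And>f g. f \<oplus>\<^bsub>L\<^esub> g = (\<lambda>x\<in>X. f x \<oplus>\<^bsub>M\<^esub> g x)"
      "\<And>c f. c \<odot>\<^bsub>L\<^esub> f = (\<lambda>x\<in>X. c \<odot>\<^bsub>M\<^esub> f x)"
  shows "module R L"
proof -
  have cl [simp]: "f x \<in> carrier M" if "f \<in> D" "x \<in> X" for f x
    using D that by auto
  have eqI: "f = g" if "f \<in> X \<rightarrow>\<^sub>E carrier M" "g \<in> X \<rightarrow>\<^sub>E carrier M" "\<And>x. x \<in> X \<Longrightarrow> f x = g x" for f g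
    by (rule PiE_ext[OF that])
  have PiE: "f \<in> X \<rightarrow>\<^sub>E carrier M" if "f \<in> D" for f
    using D that by blast
  note [simp] = zero add smult L
  show ?thesis
  proof (rule moduleI)
    show "cring R" by (rule R.is_cring)
    show "abelian_group L"
    proof (rule abelian_groupI)
      fix f assume f: "f \<in> carrier L"
      have "(\<lambda>x\<in>X. (\<ominus>\<^bsub>R\<^esub> \<one>\<^bsub>R\<^esub>) \<odot>\<^bsub>M\<^esub> f x) \<oplus>\<^bsub>L\<^esub> f = \<zero>\<^bsub>L\<^esub>"
        using f by (intro eqI) (auto simp: smult_l_minus M.l_neg)
      then show "\<exists>g\<in>carrier L. g \<oplus>\<^bsub>L\<^esub> f = \<zero>\<^bsub>L\<^esub>"
        using f by (intro bexI[of _ "\<lambda>x\<in>X. (\<ominus>\<^bsub>R\<^esub> \<one>\<^bsub>R\<^esub>) \<odot>\<^bsub>M\<^esub> f x"]) simp_all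
      show "\<zero>\<^bsub>L\<^esub> \<oplus>\<^bsub>L\<^esub> f = f"
        using f by (intro eqI) (auto simp: PiE)
    qed (auto intro!: eqI simp: M.a_ac)
  qed (auto intro!: eqI simp: PiE PiE_arb[OF PiE] smult_l_distr smult_r_distr smult_assoc1)
qed

section \<open>Differences in abelian groups\<close>

lemma (in abelian_group) diff_telescope:
  assumes "x \<in> carrier G" "y \<in> carrier G" "z \<in> carrier G"
  shows "(x \<ominus> y) \<oplus> (y \<ominus> z) = x \<ominus> z"
  using assms by (simp add: a_minus_def a_assoc r_neg1)

lemma (in abelian_group) diff_diff:
  assumes "a \<in> carrier G" "b \<in> carrier G" "c \<in> carrier G" "d \<in> carrier G"
  shows "(a \<ominus> b) \<ominus> (c \<ominus> d) = (a \<oplus> d) \<ominus> (b \<oplus> c)"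
  using assms by (simp add: a_minus_def minus_add a_ac)

lemma (in abelian_group) diff_add_diff:
  assumes "a \<in> carrier G" "b \<in> carrier G" "c \<in> carrier G" "d \<in> carrier G"
  shows "(a \<oplus> b) \<ominus> (c \<oplus> d) = (a \<ominus> c) \<oplus> (b \<ominus> d)"
  using assms by (simp add: a_minus_def minus_add a_ac)

lemma (in abelian_group) diff_cancel_middle:
  assumes "a \<in> carrier G" "b \<in> carrier G" "k \<in> carrier G" "c \<in> carrier G" "d \<in> carrier G"
  shows "(a \<oplus> (k \<oplus> b)) \<ominus> (c \<oplus> (k \<oplus> d)) = (a \<ominus> c) \<oplus> (b \<ominus> d)"
  using assms by (simp add: diff_add_diff) (simp add: a_minus_def r_neg)

section \<open>The Lie-Rinehart structure\<close>

context hopf_algebroid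
begin

text \<open>Scalars of \<open>K\<close> act on \<open>H\<close> as elements \<open>s(c 1)\<close>, so left \<open>A\<close>-linearity contains
  \<open>K\<close>-linearity.\<close>

lemma smult_eq_s:
  assumes "c \<in> carrier K" "u \<in> carrier H"
  shows "c \<odot>\<^bsub>H\<^esub> u = s (c \<odot>\<^bsub>A\<^esub> \<one>\<^bsub>A\<^esub>) \<otimes>\<^bsub>H\<^esub> u"
  using assms by (simp add: s_smult H.smult_assoc2)

lemma left_linear_smult:
  assumes "left_linear \<psi>" "c \<in> carrier K" "u \<in> carrier H"
  shows "\<psi> (c \<odot>\<^bsub>H\<^esub> u) = c \<odot>\<^bsub>A\<^esub> \<psi> u"
  using assms by (simp add: smult_eq_s left_linearD A.smult_assoc2)

text \<open>The converse of \<open>derivation_s_left_linear\<close>: the derivation rule forces \<open>\<delta>(1) = 0\<close>, and then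
  \<open>\<delta>(s a) = a \<delta>(1) = 0\<close>.\<close>

lemma derivation_sI:
  assumes ext: "\<delta> \<in> extensional (carrier H)" and ll: "left_linear \<delta>"
    and mult: "\<And>u v. \<lbrakk>u \<in> carrier H; v \<in> carrier H\<rbrakk> \<Longrightarrow>
      \<delta> (u \<otimes>\<^bsub>H\<^esub> v) = \<epsilon> u \<otimes>\<^bsub>A\<^esub> \<delta> v \<oplus>\<^bsub>A\<^esub> \<delta> u \<otimes>\<^bsub>A\<^esub> \<epsilon> v"
  shows "\<delta> \<in> derivation_s"
proof -
  have "\<delta> \<one>\<^bsub>H\<^esub> \<oplus>\<^bsub>A\<^esub> \<delta> \<one>\<^bsub>H\<^esub> = \<delta> \<one>\<^bsub>H\<^esub>"
    using mult[of "\<one>\<^bsub>H\<^esub>" "\<one>\<^bsub>H\<^esub>"] by (simp add: left_linearD[OF ll])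
  then have one: "\<delta> \<one>\<^bsub>H\<^esub> = \<zero>\<^bsub>A\<^esub>"
    by (simp add: left_linearD[OF ll])
  have "\<delta> (s a) = \<zero>\<^bsub>A\<^esub>" if "a \<in> carrier A" for a
    using left_linear_s[OF ll that, of "\<one>\<^bsub>H\<^esub>"] that by (simp add: one)
  then show ?thesis
    using ext mult
    by (auto simp: derivation_s_def derivations_along_def PiE_def linear_map_def
        left_linearD[OF ll] left_linear_smult[OF ll])
qed

lemma derivation_s_ext: "\<delta> \<in> derivation_s \<Longrightarrow> \<delta> \<in> carrier H \<rightarrow>\<^sub>E carrier A"
  by (simp add: derivation_s_def derivations_along_def)

lemma derivation_s_closed: "\<lbrakk>\<delta> \<in> derivation_s; u \<in> carrier H\<rbrakk> \<Longrightarrow> \<delta> u \<in> carrier A"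
  using derivation_s_ext by blast

lemma derivation_s_zero: "(\<lambda>u\<in>carrier H. \<zero>\<^bsub>A\<^esub>) \<in> derivation_s"
  by (rule derivation_sI) (auto simp: left_linear_def)

lemma derivation_s_add:
  assumes "\<delta> \<in> derivation_s" "\<delta>' \<in> derivation_s"
  shows "(\<lambda>u\<in>carrier H. \<delta> u \<oplus>\<^bsub>A\<^esub> \<delta>' u) \<in> derivation_s"
  using assms derivation_s_left_linear[OF assms(1)] derivation_s_left_linear[OF assms(2)]
  by (intro derivation_sI)
     (auto simp: left_linear_def derivation_s_mult A.l_distr A.r_distr A.M.a_ac)

lemma derivation_s_act:
  assumes a: "a \<in> carrier A" and \<delta>: "\<delta> \<in> derivation_s"
  shows "(\<lambda>u\<in>carrier H. a \<otimes>\<^bsub>A\<^esub> \<delta> u) \<in> derivation_s"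
  using assms derivation_s_left_linear[OF \<delta>]
  by (intro derivation_sI)
     (auto simp: left_linear_def derivation_s_mult A.r_distr A.m_ac)

lemma derivation_s_smult:
  assumes c: "c \<in> carrier K" and \<delta>: "\<delta> \<in> derivation_s"
  shows "(\<lambda>u\<in>carrier H. c \<odot>\<^bsub>A\<^esub> \<delta> u) = (\<lambda>u\<in>carrier H. (c \<odot>\<^bsub>A\<^esub> \<one>\<^bsub>A\<^esub>) \<otimes>\<^bsub>A\<^esub> \<delta> u)"
    and "(\<lambda>u\<in>carrier H. c \<odot>\<^bsub>A\<^esub> \<delta> u) \<in> derivation_s"
proof -
  show *: "(\<lambda>u\<in>carrier H. c \<odot>\<^bsub>A\<^esub> \<delta> u) = (\<lambda>u\<in>carrier H. (c \<odot>\<^bsub>A\<^esub> \<one>\<^bsub>A\<^esub>) \<otimes>\<^bsub>A\<^esub> \<delta> u)"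
    using assms by (intro restrict_ext) (simp add: A.smult_assoc2 derivation_s_closed)
  show "(\<lambda>u\<in>carrier H. c \<odot>\<^bsub>A\<^esub> \<delta> u) \<in> derivation_s"
    unfolding * using assms by (intro derivation_s_act) simp_all
qed

lemma invariant_op_plus:
  assumes \<phi>: "left_linear \<phi>" and \<psi>: "left_linear \<psi>"
    and \<chi>: "\<And>u. u \<in> carrier H \<Longrightarrow> \<chi> u = \<phi> u \<oplus>\<^bsub>A\<^esub> \<psi> u" and u: "u \<in> carrier H"
  shows "invariant_op \<chi> u = invariant_op \<phi> u \<oplus>\<^bsub>H\<^esub> invariant_op \<psi> u"
proof -
  have \<chi>l: "left_linear \<chi>"
    using \<phi> \<psi> unfolding left_linear_def by (simp add: \<chi> A.r_distr A.M.a_ac)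
  have "invariant_op \<chi> u = tensor_lift (add_monoid H)
      (\<lambda>x y. (x \<otimes>\<^bsub>H\<^esub> t (\<phi> y)) \<otimes>\<^bsub>add_monoid H\<^esub> (x \<otimes>\<^bsub>H\<^esub> t (\<psi> y))) (\<Delta> u)"
    unfolding invariant_op_def contract_def using u
    by (intro HH.lift_cong[OF H_add_group contract_balanced[OF \<chi>l]])
       (simp_all add: \<chi> t_add H.r_distr left_linearD[OF \<phi>] left_linearD[OF \<psi>])
  then show ?thesis
    using HH.lift_mult[OF H_add_group contract_balanced[OF \<phi>] contract_balanced[OF \<psi>], of "\<Delta> u"] u
    by (simp add: invariant_op_def contract_def)
qed

lemma invariant_op_act:
  assumes a: "a \<in> carrier A" and \<psi>: "left_linear \<psi>"
    and \<chi>: "\<And>u. u \<in> carrier H \<Longrightarrow> \<chi> u = a \<otimes>\<^bsub>A\<^esub> \<psi> u" and u: "u \<in> carrier H"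
  shows "invariant_op \<chi> u = t a \<otimes>\<^bsub>H\<^esub> invariant_op \<psi> u"
  unfolding invariant_op_def contract_def using u a
  by (intro HH.hom_lift[OF H_add_group H_add_group H_mult_hom contract_balanced[OF \<psi>], symmetric])
     (simp_all add: \<chi> t_mult H.m_ac left_linearD[OF \<psi>])

lemma invariant_op_minus:
  assumes \<phi>: "left_linear \<phi>" and \<psi>: "left_linear \<psi>" and \<chi>l: "left_linear \<chi>"
    and \<chi>: "\<And>u. u \<in> carrier H \<Longrightarrow> \<chi> u = \<phi> u \<ominus>\<^bsub>A\<^esub> \<psi> u" and u: "u \<in> carrier H"
  shows "invariant_op \<chi> u = invariant_op \<phi> u \<ominus>\<^bsub>H\<^esub> invariant_op \<psi> u"
proof -
  have "\<phi> v = \<chi> v \<oplus>\<^bsub>A\<^esub> \<psi> v" if "v \<in> carrier H" for v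
    using that by (simp add: \<chi> a_minus_def A.M.a_assoc A.M.l_neg left_linearD[OF \<phi>] left_linearD[OF \<psi>])
  then have "invariant_op \<phi> u = invariant_op \<chi> u \<oplus>\<^bsub>H\<^esub> invariant_op \<psi> u"
    by (rule invariant_op_plus[OF \<chi>l \<psi> _ u])
  then show ?thesis
    using u by (simp add: a_minus_def H.M.a_assoc H.M.r_neg \<chi>l \<psi>)
qed

abbreviation "bracket \<equiv> Der_s_bracket A H t \<Delta>"

lemma bracket_eq:
  assumes "\<delta> \<in> derivation_s" "\<delta>' \<in> derivation_s" "u \<in> carrier H"
  shows "bracket \<delta> \<delta>' u = \<delta> (invariant_op \<delta>' u) \<ominus>\<^bsub>A\<^esub> \<delta>' (invariant_op \<delta> u)"
  using assms by (simp add: Der_s_bracket_def tensor_lift_invariant_op derivation_s_left_linear)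

text \<open>Expanding \<open>\<delta>(R\<^sub>\<delta>\<^sub>'(u v))\<close> with the derivation rules of \<open>R\<^sub>\<delta>\<^sub>'\<close> and \<open>\<delta>\<close> produces, besides the
  terms of the derivation rule for \<open>\<delta> \<circ> R\<^sub>\<delta>\<^sub>'\<close>, the mixed terms \<open>\<delta>(u) \<delta>'(v) + \<delta>'(u) \<delta>(v)\<close>. These are
  symmetric in \<open>\<delta>\<close> and \<open>\<delta>'\<close>, so they cancel in the bracket.\<close>

lemma bracket_closed:
  assumes \<delta>: "\<delta> \<in> derivation_s" and \<delta>': "\<delta>' \<in> derivation_s"
  shows "bracket \<delta> \<delta>' \<in> derivation_s"
proof (rule derivation_sI)
  note ll = derivation_s_left_linear[OF \<delta>] and ll' = derivation_s_left_linear[OF \<delta>']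
  note D = left_linearD[OF ll] left_linearD[OF ll']
  note eq = bracket_eq[OF \<delta> \<delta>']
  show "bracket \<delta> \<delta>' \<in> extensional (carrier H)"
    by (simp add: Der_s_bracket_def)
  show "left_linear (bracket \<delta> \<delta>')"
    unfolding left_linear_def
  proof (intro conjI ballI)
    fix u assume u: "u \<in> carrier H"
    then show "bracket \<delta> \<delta>' u \<in> carrier A"
      by (simp add: eq D ll ll')
    fix v assume "v \<in> carrier H"
    then show "bracket \<delta> \<delta>' (u \<oplus>\<^bsub>H\<^esub> v) = bracket \<delta> \<delta>' u \<oplus>\<^bsub>A\<^esub> bracket \<delta> \<delta>' v"
      using u by (simp add: eq D ll ll' invariant_op_add A.M.diff_add_diff)
  next
    fix a u assume "a \<in> carrier A" "u \<in> carrier H"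
    then show "bracket \<delta> \<delta>' (s a \<otimes>\<^bsub>H\<^esub> u) = a \<otimes>\<^bsub>A\<^esub> bracket \<delta> \<delta>' u"
      by (simp add: eq D ll ll' invariant_op_s a_minus_def A.r_distr A.r_minus)
  qed
  fix u v assume uv: "u \<in> carrier H" "v \<in> carrier H"
  let ?k = "\<delta> u \<otimes>\<^bsub>A\<^esub> \<delta>' v \<oplus>\<^bsub>A\<^esub> \<delta>' u \<otimes>\<^bsub>A\<^esub> \<delta> v"
  have expand: "\<alpha> (invariant_op \<beta> (u \<otimes>\<^bsub>H\<^esub> v)) = \<epsilon> u \<otimes>\<^bsub>A\<^esub> \<alpha> (invariant_op \<beta> v) \<oplus>\<^bsub>A\<^esub>
      ((\<alpha> u \<otimes>\<^bsub>A\<^esub> \<beta> v \<oplus>\<^bsub>A\<^esub> \<beta> u \<otimes>\<^bsub>A\<^esub> \<alpha> v) \<oplus>\<^bsub>A\<^esub> \<alpha> (invariant_op \<beta> u) \<otimes>\<^bsub>A\<^esub> \<epsilon> v)"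
    if \<alpha>: "\<alpha> \<in> derivation_s" and \<beta>: "\<beta> \<in> derivation_s" for \<alpha> \<beta>
    using uv derivation_s_left_linear[OF \<alpha>] derivation_s_left_linear[OF \<beta>]
    by (simp add: invariant_op_mult \<beta> left_linear_add derivation_s_mult[OF \<alpha>] \<epsilon>_invariant_op
        derivation_s_closed[OF \<alpha>] derivation_s_closed[OF \<beta>] A.M.a_assoc)
  have comm: "\<delta>' u \<otimes>\<^bsub>A\<^esub> \<delta> v \<oplus>\<^bsub>A\<^esub> \<delta> u \<otimes>\<^bsub>A\<^esub> \<delta>' v = ?k"
    using uv by (simp add: D A.M.a_comm)
  have "bracket \<delta> \<delta>' (u \<otimes>\<^bsub>H\<^esub> v)
      = (\<epsilon> u \<otimes>\<^bsub>A\<^esub> \<delta> (invariant_op \<delta>' v) \<oplus>\<^bsub>A\<^esub> (?k \<oplus>\<^bsub>A\<^esub> \<delta> (invariant_op \<delta>' u) \<otimes>\<^bsub>A\<^esub> \<epsilon> v))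
        \<ominus>\<^bsub>A\<^esub> (\<epsilon> u \<otimes>\<^bsub>A\<^esub> \<delta>' (invariant_op \<delta> v) \<oplus>\<^bsub>A\<^esub> (?k \<oplus>\<^bsub>A\<^esub> \<delta>' (invariant_op \<delta> u) \<otimes>\<^bsub>A\<^esub> \<epsilon> v))"
    using uv expand[OF \<delta> \<delta>'] expand[OF \<delta>' \<delta>] by (simp add: eq comm)
  also have "\<dots> = (\<epsilon> u \<otimes>\<^bsub>A\<^esub> \<delta> (invariant_op \<delta>' v) \<ominus>\<^bsub>A\<^esub> \<epsilon> u \<otimes>\<^bsub>A\<^esub> \<delta>' (invariant_op \<delta> v))
      \<oplus>\<^bsub>A\<^esub> (\<delta> (invariant_op \<delta>' u) \<otimes>\<^bsub>A\<^esub> \<epsilon> v \<ominus>\<^bsub>A\<^esub> \<delta>' (invariant_op \<delta> u) \<otimes>\<^bsub>A\<^esub> \<epsilon> v)"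
    using uv by (intro A.M.diff_cancel_middle) (simp_all add: D ll ll')
  also have "\<dots> = \<epsilon> u \<otimes>\<^bsub>A\<^esub> bracket \<delta> \<delta>' v \<oplus>\<^bsub>A\<^esub> bracket \<delta> \<delta>' u \<otimes>\<^bsub>A\<^esub> \<epsilon> v"
    using uv by (simp add: eq D ll ll' a_minus_def A.r_distr A.l_distr A.r_minus A.l_minus)
  finally show "bracket \<delta> \<delta>' (u \<otimes>\<^bsub>H\<^esub> v) = \<epsilon> u \<otimes>\<^bsub>A\<^esub> bracket \<delta> \<delta>' v \<oplus>\<^bsub>A\<^esub> bracket \<delta> \<delta>' u \<otimes>\<^bsub>A\<^esub> \<epsilon> v" .
qed

lemma invariant_op_bracket:
  assumes \<delta>: "\<delta> \<in> derivation_s" and \<delta>': "\<delta>' \<in> derivation_s" and u: "u \<in> carrier H"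
  shows "invariant_op (bracket \<delta> \<delta>') u
    = invariant_op \<delta> (invariant_op \<delta>' u) \<ominus>\<^bsub>H\<^esub> invariant_op \<delta>' (invariant_op \<delta> u)"
proof -
  note ll = derivation_s_left_linear
  show ?thesis
    unfolding invariant_op_comp[OF ll[OF \<delta>] ll[OF \<delta>'] u] invariant_op_comp[OF ll[OF \<delta>'] ll[OF \<delta>] u]
    using assms
    by (intro invariant_op_minus left_linear_invariant_op ll bracket_closed) (simp_all add: bracket_eq)
qed

lemma left_linear_minus:
  assumes \<psi>: "left_linear \<psi>" and "u \<in> carrier H" "v \<in> carrier H"
  shows "\<psi> (u \<ominus>\<^bsub>H\<^esub> v) = \<psi> u \<ominus>\<^bsub>A\<^esub> \<psi> v"
proof -
  have "\<psi> u = \<psi> (u \<ominus>\<^bsub>H\<^esub> v) \<oplus>\<^bsub>A\<^esub> \<psi> v"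
    using assms by (simp add: a_minus_def H.M.a_assoc H.M.l_neg flip: left_linear_add[OF \<psi>])
  then show ?thesis
    using assms by (simp add: a_minus_def A.M.a_assoc A.M.r_neg left_linear_closed)
qed

text \<open>Each double bracket is a difference of two sums of triple composites, and the three differences
  telescope: they are \<open>p - q\<close>, \<open>q - r\<close> and \<open>r - p\<close>.\<close>

lemma bracket_jacobi:
  assumes x: "x \<in> derivation_s" and y: "y \<in> derivation_s" and z: "z \<in> derivation_s"
    and u: "u \<in> carrier H"
  shows "bracket x (bracket y z) u \<oplus>\<^bsub>A\<^esub> bracket y (bracket z x) u \<oplus>\<^bsub>A\<^esub> bracket z (bracket x y) u = \<zero>\<^bsub>A\<^esub>"
proof -
  let ?w = "\<lambda>\<alpha> \<beta> \<gamma>. \<alpha> (invariant_op \<beta> (invariant_op \<gamma> u))"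
  note ll = derivation_s_left_linear
  have w [simp]: "?w \<alpha> \<beta> \<gamma> \<in> carrier A"
    if "\<alpha> \<in> derivation_s" "\<beta> \<in> derivation_s" "\<gamma> \<in> derivation_s" for \<alpha> \<beta> \<gamma>
    using that u by (simp add: derivation_s_closed ll)
  have expand: "bracket \<alpha> (bracket \<beta> \<gamma>) u
      = (?w \<alpha> \<beta> \<gamma> \<oplus>\<^bsub>A\<^esub> ?w \<gamma> \<beta> \<alpha>) \<ominus>\<^bsub>A\<^esub> (?w \<alpha> \<gamma> \<beta> \<oplus>\<^bsub>A\<^esub> ?w \<beta> \<gamma> \<alpha>)"
    if "\<alpha> \<in> derivation_s" "\<beta> \<in> derivation_s" "\<gamma> \<in> derivation_s" for \<alpha> \<beta> \<gamma>
    using that u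
    by (simp add: bracket_eq bracket_closed invariant_op_bracket left_linear_minus ll A.M.diff_diff)
  let ?p = "?w x y z \<oplus>\<^bsub>A\<^esub> ?w z y x" and ?q = "?w x z y \<oplus>\<^bsub>A\<^esub> ?w y z x" and ?r = "?w y x z \<oplus>\<^bsub>A\<^esub> ?w z x y"
  have "bracket x (bracket y z) u = ?p \<ominus>\<^bsub>A\<^esub> ?q"
    using expand[OF x y z] .
  moreover have "bracket y (bracket z x) u = ?q \<ominus>\<^bsub>A\<^esub> ?r"
    using expand[OF y z x] x y z by (simp add: A.M.a_comm)
  moreover have "bracket z (bracket x y) u = ?r \<ominus>\<^bsub>A\<^esub> ?p"
    using expand[OF z x y] x y z by (simp add: A.M.a_comm)
  ultimately show ?thesis
    using x y z by (simp add: A.M.diff_telescope) (simp add: a_minus_def A.M.r_neg)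
qed

text \<open>\<open>\<delta>(R\<^sub>a\<^sub>\<delta>\<^sub>' u) = \<delta>(t(a) R\<^sub>\<delta>\<^sub>' u) = a \<delta>(R\<^sub>\<delta>\<^sub>' u) + \<delta>(t a) \<epsilon>(R\<^sub>\<delta>\<^sub>' u)\<close>, and
  \<open>\<epsilon>(R\<^sub>\<delta>\<^sub>' u) = \<delta>'(u)\<close>.\<close>

lemma bracket_leibniz:
  assumes x: "x \<in> derivation_s" and y: "y \<in> derivation_s" and a: "a \<in> carrier A" and u: "u \<in> carrier H"
  shows "bracket x (pointwise_act (carrier H) A a y) u
    = a \<otimes>\<^bsub>A\<^esub> bracket x y u \<oplus>\<^bsub>A\<^esub> x (t a) \<otimes>\<^bsub>A\<^esub> y u"
proof -
  note ll = derivation_s_left_linear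
  let ?ay = "pointwise_act (carrier H) A a y"
  have ay: "?ay \<in> derivation_s"
    unfolding pointwise_act_def by (rule derivation_s_act[OF a y])
  have op: "invariant_op ?ay u = t a \<otimes>\<^bsub>H\<^esub> invariant_op y u"
    by (rule invariant_op_act[OF a ll[OF y] _ u]) (simp add: pointwise_act_def)
  have "x (t a \<otimes>\<^bsub>H\<^esub> invariant_op y u) = a \<otimes>\<^bsub>A\<^esub> x (invariant_op y u) \<oplus>\<^bsub>A\<^esub> x (t a) \<otimes>\<^bsub>A\<^esub> y u"
    using u a by (simp add: derivation_s_mult[OF x] \<epsilon>_invariant_op ll[OF y])
  moreover have "?ay (invariant_op x u) = a \<otimes>\<^bsub>A\<^esub> y (invariant_op x u)"
    using u by (simp add: pointwise_act_def ll[OF x])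
  moreover have "(p \<oplus>\<^bsub>A\<^esub> q) \<ominus>\<^bsub>A\<^esub> r = (p \<ominus>\<^bsub>A\<^esub> r) \<oplus>\<^bsub>A\<^esub> q"
    if "p \<in> carrier A" "q \<in> carrier A" "r \<in> carrier A" for p q r
    using that by (simp add: a_minus_def A.M.a_ac)
  moreover have "a \<otimes>\<^bsub>A\<^esub> p \<ominus>\<^bsub>A\<^esub> a \<otimes>\<^bsub>A\<^esub> q = a \<otimes>\<^bsub>A\<^esub> (p \<ominus>\<^bsub>A\<^esub> q)"
    if "p \<in> carrier A" "q \<in> carrier A" for p q
    using that a by (simp add: a_minus_def A.r_distr A.r_minus)
  ultimately show ?thesis
    using u a x y by (simp add: bracket_eq ay op derivation_s_closed ll)
qed

lemma anchor_bracket: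
  assumes x: "x \<in> derivation_s" and y: "y \<in> derivation_s" and a: "a \<in> carrier A"
  shows "bracket x y (t a) = x (t (y (t a))) \<ominus>\<^bsub>A\<^esub> y (t (x (t a)))"
  using assms by (simp add: bracket_eq invariant_op_t derivation_s_left_linear)

lemma anchor_derivation:
  assumes \<delta>: "\<delta> \<in> derivation_s"
  shows "Der_s_anchor A t \<delta> \<in> derivations_along K A A (\<lambda>a. a)"
  using left_linear_smult[OF derivation_s_left_linear[OF \<delta>]]
  by (auto simp: derivations_along_def Der_s_anchor_def compose_def linear_map_def t_add t_mult t_smult
      derivation_s_mult[OF \<delta>] derivation_s_closed[OF \<delta>] left_linear_add[OF derivation_s_left_linear[OF \<delta>]])

lemma Der_s_eq: "Der_s K A H s \<epsilon> = pointwise_module (carrier H) A derivation_s"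
  by (simp add: Der_s_def derivation_s_def)

lemma Der_s_module: "module K (Der_s K A H s \<epsilon>)"
  unfolding Der_s_eq
  by (rule A.function_module[where D = derivation_s and X = "carrier H"])
     (auto simp: derivation_s_zero derivation_s_add derivation_s_smult(2) dest: derivation_s_ext)

lemma Der_s_act_module: "module A (with_smult (Der_s K A H s \<epsilon>) (pointwise_act (carrier H) A))"
proof -
  have "cring A" "abelian_group A" by unfold_locales
  then interpret self: module A "with_smult A (monoid.mult A)"
    by (intro moduleI with_smult_abelian_group) (simp_all add: A.l_distr A.r_distr A.m_assoc)
  show ?thesis
    unfolding Der_s_eq
    by (rule self.function_module[where D = derivation_s and X = "carrier H"])
     (auto simp: derivation_s_zero derivation_s_add derivation_s_act pointwise_act_def dest: derivation_s_ext)
qed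

lemma bracket_antisym:
  assumes "x \<in> derivation_s" "y \<in> derivation_s" "u \<in> carrier H"
  shows "bracket y x u = \<ominus>\<^bsub>A\<^esub> bracket x y u"
  using assms by (simp add: bracket_eq a_minus_def derivation_s_closed derivation_s_left_linear A.M.minus_add A.M.a_comm)

lemma bracket_add_left:
  assumes "x \<in> derivation_s" "x' \<in> derivation_s" "y \<in> derivation_s" "u \<in> carrier H"
  shows "bracket (\<lambda>v\<in>carrier H. x v \<oplus>\<^bsub>A\<^esub> x' v) y u = bracket x y u \<oplus>\<^bsub>A\<^esub> bracket x' y u"
proof -
  note ll = derivation_s_left_linear
  have "invariant_op (\<lambda>v\<in>carrier H. x v \<oplus>\<^bsub>A\<^esub> x' v) u = invariant_op x u \<oplus>\<^bsub>H\<^esub> invariant_op x' u"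
    using assms by (intro invariant_op_plus ll) simp_all
  then show ?thesis
    using assms by (simp add: bracket_eq derivation_s_add left_linear_add ll derivation_s_closed A.M.diff_add_diff)
qed

lemma bracket_smult_left:
  assumes "c \<in> carrier K" "x \<in> derivation_s" "y \<in> derivation_s" "u \<in> carrier H"
  shows "bracket (\<lambda>v\<in>carrier H. c \<odot>\<^bsub>A\<^esub> x v) y u = c \<odot>\<^bsub>A\<^esub> bracket x y u"
proof -
  note ll = derivation_s_left_linear
  have "invariant_op (\<lambda>v\<in>carrier H. c \<odot>\<^bsub>A\<^esub> x v) u = t (c \<odot>\<^bsub>A\<^esub> \<one>\<^bsub>A\<^esub>) \<otimes>\<^bsub>H\<^esub> invariant_op x u"
    using assms by (intro invariant_op_act ll) (simp_all add: A.smult_assoc2 derivation_s_closed)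
  also have "\<dots> = c \<odot>\<^bsub>H\<^esub> invariant_op x u"
    using assms by (simp add: t_smult H.smult_assoc2 ll)
  finally show ?thesis
    using assms
    by (simp add: bracket_eq derivation_s_smult(2) left_linear_smult ll derivation_s_closed
        a_minus_def A.smult_r_distr A.smult_r_minus)
qed

lemma bracket_lie_algebra: "lie_algebra K (Der_s K A H s \<epsilon>) bracket"
proof -
  interpret L: module K "Der_s K A H s \<epsilon>" by (rule Der_s_module)
  have eqI: "f = g" if "f \<in> extensional (carrier H)" "g \<in> extensional (carrier H)"
    "\<And>u. u \<in> carrier H \<Longrightarrow> f u = g u" for f g :: "'e \<Rightarrow> 'c"
    using that by (rule extensionalityI)
  have ext: "bracket x y \<in> extensional (carrier H)" for x y
    by (simp add: Der_s_bracket_def)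
  have cl: "bracket x y u \<in> carrier A" if "x \<in> derivation_s" "y \<in> derivation_s" "u \<in> carrier H" for x y u
    using that by (intro derivation_s_closed bracket_closed)
  show ?thesis
  proof (unfold_locales, unfold Der_s_eq pointwise_module_simps)
    fix x y z assume x: "x \<in> derivation_s" and y: "y \<in> derivation_s" and z: "z \<in> derivation_s"
    show "(\<lambda>u\<in>carrier H. (\<lambda>u\<in>carrier H. bracket x (bracket y z) u \<oplus>\<^bsub>A\<^esub> bracket y (bracket z x) u) u
        \<oplus>\<^bsub>A\<^esub> bracket z (bracket x y) u) = (\<lambda>u\<in>carrier H. \<zero>\<^bsub>A\<^esub>)"
      using bracket_jacobi[OF x y z] by (intro restrict_ext) simp
  next
    fix x y assume x: "x \<in> derivation_s" and y: "y \<in> derivation_s"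
    show "bracket x y \<in> derivation_s"
      by (rule bracket_closed[OF x y])
  next
    fix x assume x: "x \<in> derivation_s"
    show "bracket x x = (\<lambda>u\<in>carrier H. \<zero>\<^bsub>A\<^esub>)"
      using x by (intro eqI ext) (simp_all add: bracket_eq a_minus_def A.M.r_neg derivation_s_closed derivation_s_left_linear)
  next
    fix y assume y: "y \<in> derivation_s"
    show "linear_map K (pointwise_module (carrier H) A derivation_s) (pointwise_module (carrier H) A derivation_s)
        (\<lambda>x. bracket x y)"
      unfolding linear_map_def using y
      by (auto intro!: eqI ext bracket_closed simp: bracket_add_left bracket_smult_left)
  next
    fix x assume x: "x \<in> derivation_s"
    show "linear_map K (pointwise_module (carrier H) A derivation_s) (pointwise_module (carrier H) A derivation_s)
        (bracket x)"
      unfolding linear_map_def pointwise_module_simps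
    proof (intro conjI ballI)
      show "bracket x \<in> derivation_s \<rightarrow> derivation_s"
        using x by (auto intro: bracket_closed)
    next
      fix y z assume yz: "y \<in> derivation_s" "z \<in> derivation_s"
      show "bracket x (\<lambda>u\<in>carrier H. y u \<oplus>\<^bsub>A\<^esub> z u) = (\<lambda>u\<in>carrier H. bracket x y u \<oplus>\<^bsub>A\<^esub> bracket x z u)"
        using x yz
        by (intro eqI ext)
           (simp_all add: bracket_antisym[of _ x] bracket_add_left derivation_s_add cl A.M.minus_add)
    next
      fix c y assume cy: "c \<in> carrier K" "y \<in> derivation_s"
      show "bracket x (\<lambda>u\<in>carrier H. c \<odot>\<^bsub>A\<^esub> y u) = (\<lambda>u\<in>carrier H. c \<odot>\<^bsub>A\<^esub> bracket x y u)"
        using x cy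
        by (intro eqI ext)
           (simp_all add: bracket_antisym[of _ x] bracket_smult_left derivation_s_smult(2) cl A.smult_r_minus)
    qed
  qed
qed

lemma Der_s_lie_rinehart:
  "lie_rinehart K A (Der_s K A H s \<epsilon>) (pointwise_act (carrier H) A) bracket (Der_s_anchor A t)"
proof (intro lie_rinehart.intro lie_rinehart_axioms.intro)
  have anchor_eq: "Der_s_anchor A t x a = x (t a)" if "a \<in> carrier A" for x a
    using that by (simp add: Der_s_anchor_def compose_def)
  have eqI: "f = g" if "f \<in> extensional (carrier A)" "g \<in> extensional (carrier A)"
    "\<And>a. a \<in> carrier A \<Longrightarrow> f a = g a" for f g :: "'c \<Rightarrow> 'c"
    using that by (rule extensionalityI)
  have ext: "Der_s_anchor A t x \<in> extensional (carrier A)" for x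
    by (simp add: Der_s_anchor_def)
  show "algebra K A" ..
  show "lie_algebra K (Der_s K A H s \<epsilon>) bracket" by (rule bracket_lie_algebra)
  show "module A (with_smult (Der_s K A H s \<epsilon>) (pointwise_act (carrier H) A))" by (rule Der_s_act_module)
  show "pointwise_act (carrier H) A (c \<odot>\<^bsub>A\<^esub> a) X = c \<odot>\<^bsub>Der_s K A H s \<epsilon>\<^esub> pointwise_act (carrier H) A a X"
    if "c \<in> carrier K" "a \<in> carrier A" "X \<in> carrier (Der_s K A H s \<epsilon>)" for c a X
    using that unfolding Der_s_eq
    by (auto intro!: restrict_ext simp: pointwise_act_def A.smult_assoc2 derivation_s_closed)
  show "linear_map K (Der_s K A H s \<epsilon>) (Der K A) (Der_s_anchor A t)"
    unfolding linear_map_def Der_s_eq Der_def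
    by (auto intro!: eqI ext anchor_derivation simp: anchor_eq)
  show "linear_map A (with_smult (Der_s K A H s \<epsilon>) (pointwise_act (carrier H) A))
      (with_smult (Der K A) (pointwise_act (carrier A) A)) (Der_s_anchor A t)"
    unfolding linear_map_def Der_s_eq Der_def pointwise_act_def
    by (auto intro!: eqI ext anchor_derivation simp: anchor_eq)
  fix X Y assume "X \<in> carrier (Der_s K A H s \<epsilon>)" "Y \<in> carrier (Der_s K A H s \<epsilon>)"
  then have XY: "X \<in> derivation_s" "Y \<in> derivation_s" by (simp_all add: Der_s_eq)
  show "Der_s_anchor A t (bracket X Y) = Der_bracket A (Der_s_anchor A t X) (Der_s_anchor A t Y)"
    using XY by (intro eqI ext) (simp_all add: Der_bracket_def anchor_eq anchor_bracket derivation_s_closed)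
  show "bracket X (pointwise_act (carrier H) A a Y)
      = pointwise_act (carrier H) A a (bracket X Y) \<oplus>\<^bsub>Der_s K A H s \<epsilon>\<^esub>
        pointwise_act (carrier H) A (Der_s_anchor A t X a) Y"
    if "a \<in> carrier A" for a
    unfolding Der_s_eq using XY that bracket_leibniz[OF XY that]
    by (intro extensionalityI[of _ "carrier H"])
       (simp_all add: pointwise_act_def anchor_eq, simp add: Der_s_bracket_def)
qed

end

theorem proposition5p13:
  fixes K :: "('k, 'c) ring_scheme"
    and A :: "('k, 'a, 'd) module_scheme"
    and H :: "('k, 'h, 'e) module_scheme"
    and s t :: "'a \<Rightarrow> 'h"
    and \<Delta> :: "'h \<Rightarrow> ('h \<times> 'h \<Rightarrow>\<^sub>0 int) set"
    and \<epsilon> :: "'h \<Rightarrow> 'a"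
    and S :: "'h \<Rightarrow> 'h"
  assumes "field_char_zero K"
    and "hopf_algebroid K A H s t \<Delta> \<epsilon> S"
  shows "lie_rinehart K A (Der_s K A H s \<epsilon>) (pointwise_act (carrier H) A)
           (Der_s_bracket A H t \<Delta>) (Der_s_anchor A t)"
  using assms(2) by (rule hopf_algebroid.Der_s_lie_rinehart)

end
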